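(* There are constants $C=C(n)>0$ and $\theta=\theta(n)\in(0,1)$, depending only on $n$, such that for all $x',x''\in\mathbb R^n$, $r_1,r_2>0$, $a>0$, $T>0$ and all $u_0\in C_0^\infty(\mathbb R^n;\mathbb C)$, $$\int_{B_{r_2}(x'')}|u(x,T;u_0)|^2\,dx\le C r_2^n\big((aT)\wedge r_1\big)^{-n}\Big(\int_{B_{r_1}(x')}|u(x,T;u_0)|^2\,dx\Big)^{\theta^p}\Big(\int_{\mathbb R^n}e^{a|x|}|u_0(x)|^2\,dx\Big)^{1-\theta^p},$$ where $$p=1+\frac{|x'-x''|+r_1+r_2}{(aT)\wedge r_1}.$$
   Context: Here $n\in\{1,2,\dots\}$ is fixed. For $u_0\in L^2(\mathbb R^n;\mathbb C)$ and $t\ge 0$, $u(x,t;u_0)=(e^{i\Delta t}u_0)(x)$ denotes the solution of the free Schrödinger equation $i\partial_t u+\Delta u=0$ in $\mathbb R^n\times(0,\infty)$ with $u(x,0)=u_0(x)$. $B_r(x)$ is the closed ball in $\mathbb R^n$ centered at $x$ of radius $r$. $|x|$ is the Euclidean norm and $a\wedge b=\min\{a,b\}$. *)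

theory Defs
  imports "HOL-Analysis.Analysis"
begin

primrec continuously_differentiable ::
    "nat \<Rightarrow> ('a::real_normed_vector \<Rightarrow> 'b::real_normed_vector) \<Rightarrow> bool" where
  "continuously_differentiable 0 f \<longleftrightarrow> continuous_on UNIV f"
| "continuously_differentiable (Suc k) f \<longleftrightarrow>
     (\<forall>x. f differentiable at x) \<and>
     (\<forall>v. continuously_differentiable k (\<lambda>x. frechet_derivative f (at x) v))"

definition test_function :: "('a::euclidean_space \<Rightarrow> complex) \<Rightarrow> bool" where
  "test_function f \<longleftrightarrow>
     (\<forall>k. continuously_differentiable k f) \<and> compact (closure {x. f x \<noteq> 0})"

text \<open>Fourier transform with the unitary normalisation:
  the integral over the whole space of \<open>exp (- \<i> x \<bullet> \<xi>) f x\<close>, times \<open>(2 \<pi>)\<close> to the power \<open>- n / 2\<close>.\<close>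

definition fourier_transform :: "('a::euclidean_space \<Rightarrow> complex) \<Rightarrow> 'a \<Rightarrow> complex" where
  "fourier_transform f \<xi> =
     ((2 * pi) powr (- real DIM('a) / 2)) *\<^sub>R (LINT x|lborel. cis (- (x \<bullet> \<xi>)) * f x)"

text \<open>The free propagator \<open>exp (\<i> t \<Delta>)\<close> is the Fourier multiplier with symbol
  \<open>exp (- \<i> t |\<xi>|\<^sup>2)\<close>.  The inverse Fourier transform is written as an integral, so the
  definition is meaningful at every point for initial data which are integrable together with
  their Fourier transform, in particular for test functions; it is not meant for
  general square-integrable data, where that integral need not converge.\<close>

definition schrodinger :: "real \<Rightarrow> ('a::euclidean_space \<Rightarrow> complex) \<Rightarrow> 'a \<Rightarrow> complex" where
  "schrodinger t u0 x =
     ((2 * pi) powr (- real DIM('a) / 2)) *\<^sub>R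
       (LINT \<xi>|lborel. cis (x \<bullet> \<xi>) * (cis (- (t * (norm \<xi>)\<^sup>2)) * fourier_transform u0 \<xi>))"

end

theory Submission
  imports Defs
    "HOL-Probability.Characteristic_Functions"
    "HOL-Probability.Sinc_Integral"
    "HOL-Complex_Analysis.Conformal_Mappings"
begin

text \<open>
  Completing the square in the Schroedinger kernel gives, with \<open>n\<close> the dimension,
  \<open>|u(x, T)| = (4 \<pi> T)\<^bsup>- n / 2\<^esup> |f x|\<close>, where \<open>f\<close> is the Fourier integral
  \<open>f x = \<integral> exp (- \<i> x \<bullet> y / (2 T)) g y dy\<close> of the chirped datum
  \<open>g y = exp (\<i> |y|\<^sup>2 / (4 T)) u0 y\<close> (\<open>norm_schrodinger_eq_chirp_fourier\<close>).
  The weight \<open>exp (a |y|)\<close> on \<open>|u0|\<^sup>2 = |g|\<^sup>2\<close> says that \<open>f\<close> is analytic in a strip of width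
  comparable to \<open>a T\<close>.  The claim is therefore a propagation of smallness for such functions, from
  one real ball to another, and the iterated exponent \<open>\<theta>\<^bsup>p\<^esup>\<close> reflects that smallness is transported
  in about \<open>p\<close> steps of length comparable to \<open>\<rho> = min (a T) r1\<close>, each of them costing a fixed power.

  Analyticity is used only through finite differences, never through complex values of \<open>x\<close>.
  For \<open>z\<close> on the unit circle expand \<open>1 = ((1 - z) + z)\<^bsup>2 N - 1\<^esup>\<close>.  The terms with at least
  \<open>N\<close> factors \<open>1 - z\<close> are at most \<open>8\<^bsup>N\<^esup> |1 - z|\<^bsup>N\<^esup>\<close> in total; the others form a polynomial in
  \<open>z\<close> that involves only the powers from \<open>N\<close> to \<open>2 N - 1\<close> and whose coefficients sum to at most
  \<open>8\<^bsup>N\<^esup>\<close> in absolute value.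
  Reading \<open>z\<close> as the translation by \<open>h\<close> recovers \<open>f x\<close> from the values
  \<open>f (x + j h)\<close>, \<open>N \<le> j < 2 N\<close>.  When \<open>N |h|\<close> is a small multiple of \<open>a T\<close>, the error is at most
  \<open>M / 8\<^bsup>N\<^esup>\<close> with \<open>M = \<integral> exp (a |y| / 4) |g y| dy\<close>, because \<open>(t / N)\<^bsup>N\<^esup> \<le> exp t\<close>
  (\<open>extrapolable_fourier_integral\<close>).

  Consequently, if \<open>|f| \<le> m\<close> on a ball of radius \<open>R\<close>, then \<open>|f| \<le> 8\<^bsup>N\<^esup> m + M / 8\<^bsup>N\<^esup>\<close> on the
  concentric ball of radius \<open>R + d\<close>, with \<open>d\<close> comparable to \<open>\<rho>\<close>; a suitable \<open>N\<close> makes this at most \<open>9 \<surd>(m M)\<close> (\<open>geometric_interpolation\<close>, \<open>extrapolable_enlarge_ball\<close>).  Iterating from the ball around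
  \<open>x'\<close> until the ball around \<open>x''\<close> is covered gives the exponent.  The first step must start from an
  \<open>L\<^sup>2\<close> bound instead of a supremum: averaging the extrapolation formula over a small ball of steps \<open>h\<close>
  replaces the values of \<open>f\<close> by its mean over a ball (\<open>extrapolable_mean_value\<close>).  Finally, the
  Cauchy-Schwarz inequality bounds \<open>M\<^sup>2\<close> by the weighted norm of \<open>u0\<close> times a constant multiple of
  \<open>(a T)\<^bsup>- n\<^esup>\<close> (in the normalisation of \<open>u\<close>), and integrating the pointwise bound over the second
  ball produces the factor \<open>r2\<^bsup>n\<^esup>\<close>.
\<close>

section \<open>Integration on Euclidean space\<close>

lemma borel_measurable_cis [measurable]: "cis \<in> borel_measurable borel"
  by (intro borel_measurable_continuous_onI continuous_on_cis continuous_on_id)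

lemma lborel_integral_affine:
  fixes f :: "'a::euclidean_space \<Rightarrow> 'b::{banach, second_countable_topology}"
  assumes "c \<noteq> 0" and [measurable]: "f \<in> borel_measurable borel"
  shows "(LINT x|lborel. f x) = \<bar>c\<bar> ^ DIM('a) *\<^sub>R (LINT x|lborel. f (t + c *\<^sub>R x))"
proof -
  have "(LINT x|lborel. f x) =
      (LINT x|density (distr lborel borel (\<lambda>x. t + c *\<^sub>R x)) (\<lambda>_. \<bar>c\<bar> ^ DIM('a)). f x)"
    using lborel_affine[OF assms(1), of t] by simp
  also have "\<dots> = (LINT x|distr lborel borel (\<lambda>x. t + c *\<^sub>R x). \<bar>c\<bar> ^ DIM('a) *\<^sub>R f x)"
    by (subst integral_density) auto
  also have "\<dots> = (LINT x|lborel. \<bar>c\<bar> ^ DIM('a) *\<^sub>R f (t + c *\<^sub>R x))"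
    by (subst integral_distr) auto
  finally show ?thesis by simp
qed

lemma
  fixes f :: "'a::euclidean_space \<Rightarrow> real \<Rightarrow> 'b::{real_normed_field,banach,second_countable_topology}"
  assumes f: "\<And>b. b \<in> Basis \<Longrightarrow> integrable lborel (f b)"
  shows integrable_lborel_prod_Basis: "integrable lborel (\<lambda>x. \<Prod>b\<in>Basis. f b (x \<bullet> b))"
    and integral_lborel_prod_Basis:
      "(LINT x|lborel. (\<Prod>b\<in>Basis. f b (x \<bullet> b))) = (\<Prod>b\<in>Basis. (LINT x|lborel. f b x))"
proof -
  interpret product_sigma_finite "\<lambda>_::'a. lborel :: real measure" ..
  have [measurable]: "f b \<in> borel_measurable borel" if "b \<in> Basis" for b
    using borel_measurable_integrable[OF f[OF that]] by simp
  have eq: "(\<lambda>x. \<Prod>b\<in>Basis. f b ((\<Sum>b\<in>Basis. x b *\<^sub>R b) \<bullet> b)) = (\<lambda>x. \<Prod>b\<in>Basis. f b (x b))"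
    by (intro ext prod.cong) auto
  show "integrable lborel (\<lambda>x. \<Prod>b\<in>Basis. f b (x \<bullet> b))"
    by (subst lborel_eq, subst integrable_distr_eq, measurable)
      (simp add: eq product_integrable_prod f)
  show "(LINT x|lborel. (\<Prod>b\<in>Basis. f b (x \<bullet> b))) = (\<Prod>b\<in>Basis. (LINT x|lborel. f b x))"
    by (subst lborel_eq, subst integral_distr, measurable)
      (simp add: eq product_integral_prod f)
qed

lemma integral_cball_affine:
  fixes F :: "'a::euclidean_space \<Rightarrow> real"
  assumes "0 < c" and F: "F \<in> borel_measurable borel"
  shows "(LINT x:cball t (c * r)|lborel. F x) = c ^ DIM('a) * (LINT h:cball 0 r|lborel. F (t + c *\<^sub>R h))"
proof -
  have "indicator (cball t (c * r)) (t + c *\<^sub>R h) = (indicator (cball 0 r) h :: real)" for h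
    using assms(1) by (simp add: indicator_def dist_norm)
  moreover have "(\<lambda>x. indicator (cball t (c * r)) x *\<^sub>R F x) \<in> borel_measurable borel"
    by (intro borel_measurable_scaleR borel_measurable_indicator F) simp
  ultimately show ?thesis
    unfolding set_lebesgue_integral_def
    using assms(1) by (subst lborel_integral_affine[where c = c and t = t]) simp_all
qed

lemma integrable_indicator_cball:
  "integrable lborel (indicator (cball z r) :: 'a::euclidean_space \<Rightarrow> real)"
  using emeasure_lborel_cball_finite[of z r] by (simp add: top.not_eq_extremum)

lemma set_integrable_cball_continuous:
  fixes F :: "'a::euclidean_space \<Rightarrow> real"
  assumes "continuous_on UNIV F"
  shows "set_integrable lborel (cball z r) F"
  unfolding set_integrable_def
  using borel_integrable_compact[OF compact_cball continuous_on_subset[OF assms subset_UNIV]]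
  by (simp add: indicator_scaleR_eq_if if_distrib)

lemma set_integral_cball_mono:
  fixes F :: "'a::euclidean_space \<Rightarrow> real"
  assumes "continuous_on UNIV F" "\<And>x. 0 \<le> F x" "cball x r \<subseteq> cball z s"
  shows "(LINT y:cball x r|lborel. F y) \<le> (LINT y:cball z s|lborel. F y)"
  unfolding set_lebesgue_integral_def
  using assms(2,3) set_integrable_cball_continuous[OF assms(1), unfolded set_integrable_def]
  by (intro integral_mono) (auto simp: indicator_def)

lemma integral_Cauchy_Schwarz:
  fixes f g :: "'a \<Rightarrow> real"
  assumes [measurable]: "f \<in> borel_measurable M" "g \<in> borel_measurable M"
    and f2: "integrable M (\<lambda>x. (f x)\<^sup>2)" and g2: "integrable M (\<lambda>x. (g x)\<^sup>2)"
  shows "(LINT x|M. f x * g x)\<^sup>2 \<le> (LINT x|M. (f x)\<^sup>2) * (LINT x|M. (g x)\<^sup>2)"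
proof -
  have int: "integrable M (\<lambda>x. f x * g x)"
  proof (rule Bochner_Integration.integrable_bound[OF Bochner_Integration.integrable_add[OF f2 g2]])
    have "\<bar>f x * g x\<bar> \<le> (f x)\<^sup>2 + (g x)\<^sup>2" for x
    proof -
      have "2 * (\<bar>f x\<bar> * \<bar>g x\<bar>) \<le> (f x)\<^sup>2 + (g x)\<^sup>2"
        using sum_squares_bound[of "\<bar>f x\<bar>" "\<bar>g x\<bar>"] by (simp add: mult.assoc)
      moreover have "0 \<le> \<bar>f x\<bar> * \<bar>g x\<bar>" by simp
      ultimately show ?thesis unfolding abs_mult by linarith
    qed
    then show "AE x in M. norm (f x * g x) \<le> norm ((f x)\<^sup>2 + (g x)\<^sup>2)" by auto
  qed auto
  have "ennreal ((LINT x|M. \<bar>f x * g x\<bar>)\<^sup>2) = (\<integral>\<^sup>+x. ennreal \<bar>f x\<bar> * ennreal \<bar>g x\<bar> \<partial>M)\<^sup>2"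
    using nn_integral_eq_integral[OF integrable_abs[OF int]]
    by (simp add: abs_mult flip: ennreal_mult ennreal_power)
  also have "\<dots> \<le> (\<integral>\<^sup>+x. (ennreal \<bar>f x\<bar>)\<^sup>2 \<partial>M) * (\<integral>\<^sup>+x. (ennreal \<bar>g x\<bar>)\<^sup>2 \<partial>M)"
    by (rule Cauchy_Schwarz_nn_integral) auto
  also have "\<dots> = ennreal ((LINT x|M. (f x)\<^sup>2) * (LINT x|M. (g x)\<^sup>2))"
    using f2 g2 by (simp add: nn_integral_eq_integral ennreal_power ennreal_mult)
  finally have "(LINT x|M. \<bar>f x * g x\<bar>)\<^sup>2 \<le> (LINT x|M. (f x)\<^sup>2) * (LINT x|M. (g x)\<^sup>2)"
    by (simp add: ennreal_le_iff)
  moreover have "(LINT x|M. f x * g x)\<^sup>2 \<le> (LINT x|M. \<bar>f x * g x\<bar>)\<^sup>2"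
    by (rule abs_le_square_iff[THEN iffD1]) (use integral_abs_bound[of M "\<lambda>x. f x * g x"] in simp)
  ultimately show "(LINT x|M. f x * g x)\<^sup>2 \<le> (LINT x|M. (f x)\<^sup>2) * (LINT x|M. (g x)\<^sup>2)"
    by linarith
qed

text \<open>Comparison with the Cauchy density avoids splitting the line at the kink of the absolute value.\<close>

lemma integrable_exp_minus_abs:
  assumes "0 < (c::real)"
  shows "integrable lborel (\<lambda>x::real. exp (- (c * \<bar>x\<bar>)))"
proof -
  have "integrable lborel (\<lambda>x::real. inverse (1 + x\<^sup>2))"
    using integrable_inverse_1_plus_square by (simp add: set_integrable_def)
  then have i: "integrable lborel (\<lambda>x::real. 2 * inverse (1 + (0 + c * x)\<^sup>2))"
    by (intro integrable_mult_right lborel_integrable_real_affine) (use assms in auto)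
  show ?thesis
  proof (rule Bochner_Integration.integrable_bound[OF i])
    have "exp (- (c * \<bar>x\<bar>)) \<le> 2 * inverse (1 + (0 + c * x)\<^sup>2)" for x
    proof -
      have p: "0 \<le> c * \<bar>x\<bar>" using assms by simp
      have "1 + (0 + c * x)\<^sup>2 \<le> 2 * exp (c * \<bar>x\<bar>)"
        using exp_lower_Taylor_quadratic[OF p] p by (simp add: power_mult_distrib)
      moreover have "0 < 1 + (0 + c * x)\<^sup>2" by (rule add_pos_nonneg) auto
      ultimately show ?thesis by (simp add: exp_minus field_simps)
    qed
    then show "AE x in lborel. norm (exp (- (c * \<bar>x\<bar>))) \<le> norm (2 * inverse (1 + (0 + c * x)\<^sup>2))"
      by (intro AE_I2) (auto intro: order_trans)
  qed auto
qed

text \<open>The Euclidean norm dominates the mean of the absolute values of the coordinates, so a product of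
  one-dimensional exponentials is an integrable majorant.\<close>

lemma integrable_exp_minus_norm:
  assumes "0 < c"
  shows "integrable lborel (\<lambda>y::'a::euclidean_space. exp (- (c * norm y)))"
proof -
  define e where "e = c / DIM('a)"
  have e: "0 < e" "e * DIM('a) = c" using assms by (auto simp: e_def)
  have i: "integrable lborel (\<lambda>y::'a. \<Prod>b\<in>Basis. exp (- (e * \<bar>y \<bullet> b\<bar>)))"
    by (rule integrable_lborel_prod_Basis) (rule integrable_exp_minus_abs[OF e(1)])
  show ?thesis
  proof (rule Bochner_Integration.integrable_bound[OF i])
    have "exp (- (c * norm y)) \<le> (\<Prod>b\<in>Basis. exp (- (e * \<bar>y \<bullet> b\<bar>)))" for y :: 'a
    proof -
      have "(\<Sum>b\<in>Basis. e * \<bar>y \<bullet> b\<bar>) \<le> (\<Sum>b\<in>(Basis::'a set). e * norm y)"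
        using e by (intro sum_mono mult_left_mono Basis_le_norm) auto
      also have "\<dots> = c * norm y" unfolding e(2)[symmetric] by simp
      finally show ?thesis by (simp add: sum_negf flip: exp_sum)
    qed
    then show "AE y::'a in lborel. norm (exp (- (c * norm y))) \<le> norm (\<Prod>b\<in>Basis. exp (- (e * \<bar>y \<bullet> b\<bar>)))"
      by (intro AE_I2) (simp add: abs_prod)
  qed auto
qed

lemma integral_exp_minus_norm_scale:
  assumes "0 < c"
  shows "(LINT y::'a::euclidean_space|lborel. exp (- (c * norm y)))
    = (1 / c) ^ DIM('a) * (LINT y::'a|lborel. exp (- norm y))"
  using assms by (subst lborel_integral_affine[where c = "1 / c" and t = 0]) auto

lemma continuous_fourier_integral:
  fixes g :: "'a::euclidean_space \<Rightarrow> complex"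
  assumes g: "integrable lborel g"
  shows "continuous_on UNIV (\<lambda>x. LINT y|lborel. cis (s * (x \<bullet> y)) * g y)"
proof (clarsimp simp: continuous_on_sequentially comp_def)
  fix u :: "nat \<Rightarrow> 'a" and x assume u: "u \<longlonglongrightarrow> x"
  have [measurable]: "g \<in> borel_measurable borel" using g by auto
  show "(\<lambda>n. LINT y|lborel. cis (s * (u n \<bullet> y)) * g y) \<longlonglongrightarrow> (LINT y|lborel. cis (s * (x \<bullet> y)) * g y)"
  proof (rule integral_dominated_convergence[OF _ _ integrable_norm[OF g]])
    show "AE y in lborel. (\<lambda>n. cis (s * (u n \<bullet> y)) * g y) \<longlonglongrightarrow> cis (s * (x \<bullet> y)) * g y"
      by (intro AE_I2 tendsto_intros u)
  qed (auto simp: norm_mult)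
qed

section \<open>The Fourier transform of a complex Gaussian\<close>

lemma integrable_gaussian:
  assumes "0 < (c::real)"
  shows "integrable lborel (\<lambda>x::real. exp (- (c * x\<^sup>2)))"
proof -
  have "integrable lborel (\<lambda>x. normal_density 0 (1 / sqrt (2*c)) x)"
    using assms by (intro integrable_normal_density) auto
  then have "integrable lborel (\<lambda>x. sqrt (pi/c) * normal_density 0 (1 / sqrt (2*c)) x)"
    by simp
  moreover have "sqrt (pi/c) * normal_density 0 (1 / sqrt (2*c)) x = exp (- (c * x\<^sup>2))" for x
    using assms by (simp add: normal_density_def field_simps power_divide)
  ultimately show ?thesis by simp
qed

text \<open>This is the characteristic function of the standard normal distribution after a change of
  scale.  The right-hand side is already written in the form that makes sense for complex \<open>c\<close>.\<close>

lemma fourier_gaussian_real_scale: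
  assumes "0 < (c::real)"
  shows "(LINT x|lborel. cis (z * x) * exp (- (of_real c * (of_real x)\<^sup>2)))
    = csqrt (of_real pi / of_real c) * exp (- ((of_real z)\<^sup>2 / (4 * of_real c)))"
proof -
  define s where "s = sqrt (2 * c)"
  have s: "s > 0" "s\<^sup>2 = 2 * c" using assms by (auto simp: s_def)
  have "char std_normal_distribution (z / s)
      = (LINT x|lborel. std_normal_density x *\<^sub>R iexp (z / s * x))"
    unfolding char_def
    by (subst integral_density) auto
  then have 1: "(LINT x|lborel. std_normal_density x *\<^sub>R iexp (z / s * x)) = exp (- (z/s)\<^sup>2 / 2)"
    by (simp add: char_std_normal_distribution)
  have "(LINT x|lborel. cis (z * x) * exp (- (of_real c * (of_real x)\<^sup>2)))
      = \<bar>1 / s\<bar> *\<^sub>R (LINT x|lborel. cis (z * (0 + (1/s) * x)) * exp (- (of_real c * (of_real (0 + (1/s) * x))\<^sup>2)))"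
    using s by (subst lborel_integral_real_affine[where t = 0 and c = "1/s"]) auto
  also have "(\<lambda>x. cis (z * (0 + (1/s) * x)) * exp (- (of_real c * (of_real (0 + (1/s) * x))\<^sup>2)))
    = (\<lambda>x. sqrt (2 * pi) * (std_normal_density x *\<^sub>R iexp (z / s * x)))"
  proof
    fix x :: real
    have "exp (- (of_real c * (of_real y)\<^sup>2)) = complex_of_real (exp (- (c * y\<^sup>2)))" for y
      by (simp flip: exp_of_real)
    moreover have "- (c * (0 + (1/s) * x)\<^sup>2) = - x\<^sup>2 / 2"
      using s assms by (simp add: power_mult_distrib power_divide)
    ultimately have "exp (- (of_real c * (of_real (0 + (1/s) * x))\<^sup>2)) = complex_of_real (exp (- x\<^sup>2 / 2))"
      by (simp only:)
    then show "cis (z * (0 + (1/s) * x)) * exp (- (of_real c * (of_real (0 + (1/s) * x))\<^sup>2))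
      = sqrt (2 * pi) * (std_normal_density x *\<^sub>R iexp (z / s * x))"
      by (simp add: std_normal_density_def cis_conv_exp scaleR_conv_of_real mult_ac)
  qed
  finally have "(LINT x|lborel. cis (z * x) * exp (- (of_real c * (of_real x)\<^sup>2)))
     = (1/s) *\<^sub>R (sqrt (2 * pi) * complex_of_real (exp (- (z/s)\<^sup>2 / 2)))"
    using s unfolding integral_mult_right_zero[of lborel "of_real (sqrt (2 * pi))"] 1 by simp
  also have "\<dots> = of_real (sqrt (2*pi) / s) * of_real (exp (- (z\<^sup>2 / (4 * c))))"
    using s by (simp add: scaleR_conv_of_real power_divide)
  also have "sqrt (2*pi) / s = sqrt (pi / c)"
    unfolding s_def real_sqrt_divide[symmetric] by simp
  also have "complex_of_real (sqrt (pi/c)) = csqrt (of_real pi / of_real c)"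
    using assms csqrt_of_real[of "pi / c"] by (simp del: csqrt_of_real_nonneg)
  finally show ?thesis by (simp flip: exp_of_real)
qed

lemma integrable_fourier_gaussian:
  assumes "0 < Re w"
  shows "integrable lborel (\<lambda>x. cis (z * x) * exp (- (w * (of_real x)\<^sup>2)))"
proof (rule Bochner_Integration.integrable_bound[OF integrable_gaussian[OF assms]])
  show "(\<lambda>x. cis (z * x) * exp (- (w * (of_real x)\<^sup>2))) \<in> borel_measurable lborel"
    by measurable
qed (auto simp: norm_mult)

text \<open>Around a real centre \<open>r\<close> the factor \<open>exp (- (w - r) x\<^sup>2)\<close> is expanded into its exponential
  series and integrated term by term; the majorant \<open>exp (- (r - |w - r|) x\<^sup>2)\<close> is integrable exactly
  when \<open>|w - r| < r\<close>.  The discs with these centres and radii exhaust the right half plane.\<close>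

lemma holomorphic_fourier_gaussian:
  "(\<lambda>w. LINT x|lborel. cis (z * x) * exp (- (w * (of_real x)\<^sup>2))) holomorphic_on {w. 0 < Re w}"
  (is "?H holomorphic_on _")
proof -
  have ball: "?H holomorphic_on ball (of_real r) r" if "r > 0" for r
  proof (rule power_series_holomorphic)
    fix w :: complex assume "w \<in> ball (of_real r) r"
    define s where "s = cmod (w - of_real r)"
    then have s: "0 \<le> s" "s < r"
      using \<open>w \<in> _\<close> by (auto simp: dist_norm norm_minus_commute)
    define F where "F n x = cis (z * x) * exp (- (of_real r * (of_real x)\<^sup>2))
        * ((- ((w - of_real r) * (of_real x)\<^sup>2)) ^ n /\<^sub>R fact n)" for n x
    have [measurable]: "F n \<in> borel_measurable borel" for n unfolding F_def by measurable
    have exp_sums: "(\<lambda>n. F n x) sums (cis (z * x) * exp (- (w * (of_real x)\<^sup>2)))" for x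
    proof -
      have "exp (- (w * (of_real x)\<^sup>2)) =
          exp (- (of_real r * (of_real x)\<^sup>2)) * exp (- ((w - of_real r) * (of_real x)\<^sup>2))"
        unfolding exp_add[symmetric] by (simp add: algebra_simps)
      then show ?thesis
        unfolding F_def
        using sums_mult[OF exp_converges[of "- ((w - of_real r) * (of_real x)\<^sup>2)"],
            of "cis (z * x) * exp (- (of_real r * (of_real x)\<^sup>2))"]
        by (simp only: mult.assoc)
    qed
    have bound: "(\<Sum>i<n. cmod (F i x)) \<le> exp (- ((r - s) * x\<^sup>2))" for n x
    proof -
      have "(\<Sum>i<n. cmod (F i x)) = exp (- (r * x\<^sup>2)) * (\<Sum>i<n. (s * x\<^sup>2) ^ i /\<^sub>R fact i)"
        unfolding sum_distrib_left
        by (intro sum.cong refl) (simp add: F_def norm_mult norm_power s_def power_mult_distrib)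
      also have "(\<Sum>i<n. (s * x\<^sup>2) ^ i /\<^sub>R fact i) \<le> exp (s * x\<^sup>2)"
        using s unfolding exp_def
        by (intro sum_le_suminf summable_exp_generic) auto
      also have "exp (- (r * x\<^sup>2)) * exp (s * x\<^sup>2) = exp (- ((r - s) * x\<^sup>2))"
        by (simp add: algebra_simps flip: exp_add)
      finally show ?thesis by simp
    qed
    have intF: "integrable lborel (F n)" for n
    proof (rule Bochner_Integration.integrable_bound[OF integrable_gaussian[of "r - s"]])
      have "cmod (F n x) \<le> (\<Sum>i<Suc n. cmod (F i x))" for x
        by (simp add: sum_nonneg)
      then show "AE x in lborel. norm (F n x) \<le> norm (exp (- ((r - s) * x\<^sup>2)))"
        using bound[of _ "Suc n"] by (auto intro!: AE_I2 intro: order_trans simp del: sum.lessThan_Suc)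
    qed (use s in auto)
    \<comment> \<open>Term-by-term integration is dominated convergence for the partial sums.\<close>
    have "(\<lambda>n. LINT x|lborel. (\<Sum>i<n. F i x)) \<longlonglongrightarrow> ?H w"
    proof (rule integral_dominated_convergence[OF _ _ integrable_gaussian[of "r - s"]])
      show "AE x in lborel. (\<lambda>n. \<Sum>i<n. F i x) \<longlonglongrightarrow> cis (z * x) * exp (- (w * (of_real x)\<^sup>2))"
        using exp_sums by (auto simp: sums_def)
      show "AE x in lborel. norm (\<Sum>i<n. F i x) \<le> exp (- ((r - s) * x\<^sup>2))" for n
        using bound[of _ n] by (auto intro!: AE_I2 intro: order_trans[OF norm_sum])
    qed (use s in auto)
    then have "(\<lambda>n. LINT x|lborel. F n x) sums ?H w"
      unfolding sums_def using intF by simp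
    moreover have "(LINT x|lborel. F n x) = (LINT x|lborel. cis (z * x) * exp (- (of_real r * (of_real x)\<^sup>2))
        * ((- ((of_real x)\<^sup>2)) ^ n /\<^sub>R fact n)) * (w - of_real r) ^ n" for n
    proof -
      have "(- ((w - of_real r) * y)) ^ n = (- y) ^ n * (w - of_real r) ^ n" for y
        unfolding power_mult_distrib[symmetric] by (simp add: mult.commute)
      then show ?thesis
        unfolding integral_mult_left_zero[symmetric] F_def
        by (simp only: mult_scaleR_left mult_scaleR_right mult.assoc)
    qed
    ultimately show "(\<lambda>n. (LINT x|lborel. cis (z * x) * exp (- (of_real r * (of_real x)\<^sup>2))
        * ((- ((of_real x)\<^sup>2)) ^ n /\<^sub>R fact n)) * (w - of_real r) ^ n) sums ?H w"
      by simp
  qed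
  have "?H field_differentiable at w" if "0 < Re w" for w
  proof -
    \<comment> \<open>Any \<open>r > |w|\<^sup>2 / (2 Re w)\<close> puts \<open>w\<close> into the disc of radius \<open>r\<close> around \<open>r\<close>.\<close>
    define r where "r = (cmod w)\<^sup>2 / Re w"
    have r: "r > 0" using that by (auto simp: r_def intro!: divide_pos_pos)
    have "(cmod (of_real r - w))\<^sup>2 = r\<^sup>2 - 2 * r * Re w + (cmod w)\<^sup>2"
      unfolding cmod_power2 by (simp add: power2_eq_square algebra_simps)
    also have "2 * r * Re w = 2 * (cmod w)\<^sup>2"
      using that by (simp add: r_def)
    also have "r\<^sup>2 - 2 * (cmod w)\<^sup>2 + (cmod w)\<^sup>2 < r\<^sup>2"
      using that by auto
    finally have "w \<in> ball (of_real r) r"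
      using r by (simp add: dist_norm power_less_imp_less_base)
    then show ?thesis
      using holomorphic_on_imp_differentiable_at[OF ball[OF r]] by auto
  qed
  then show ?thesis
    by (auto simp: holomorphic_on_def intro: field_differentiable_at_within)
qed

text \<open>Both sides are holomorphic in the right half plane and agree on the positive reals.  The
  principal square root is the right branch because \<open>\<pi> / w\<close> stays in the right half plane.\<close>

lemma fourier_gaussian_complex_scale:
  assumes "0 < Re w"
  shows "(LINT x|lborel. cis (z * x) * exp (- (w * (of_real x)\<^sup>2)))
    = csqrt (of_real pi / w) * exp (- ((of_real z)\<^sup>2 / (4 * w)))"
proof -
  define S where "S = {w. 0 < Re w}"
  define D where "D w = (LINT x|lborel. cis (z * x) * exp (- (w * (of_real x)\<^sup>2)))
      - csqrt (of_real pi / w) * exp (- ((of_real z)\<^sup>2 / (4 * w)))" for w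
  have pos: "of_real pi / w \<notin> \<real>\<^sub>\<le>\<^sub>0" if "w \<in> S" for w
  proof -
    have "0 < Re (of_real pi / w)"
      using that by (auto simp: S_def Re_divide sum_power2_gt_zero_iff)
    then show ?thesis by (auto simp: complex_nonpos_Reals_iff)
  qed
  have "D w = 0"
  proof (rule analytic_continuation[where f = D and S = S and U = "of_real ` {0<..}" and \<xi> = 1])
    show "D holomorphic_on S"
      unfolding D_def using pos
      by (intro holomorphic_intros holomorphic_fourier_gaussian[folded S_def]) (auto simp: S_def)
    show "open S" "connected S"
      by (auto simp: S_def open_halfspace_Re_gt convex_connected convex_halfspace_Re_gt)
    show "of_real ` {0<..} \<subseteq> S" by (auto simp: S_def)
    show "1 islimpt (of_real ` {0::real<..} :: complex set)"
      unfolding islimpt_approachable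
    proof safe
      fix e :: real assume "e > 0"
      then have "complex_of_real (1 + e / 2) \<in> of_real ` {0<..}"
        by (intro imageI) auto
      moreover have "dist (complex_of_real (1 + e / 2)) 1 = e / 2"
        using \<open>e > 0\<close> by (simp add: dist_norm)
      ultimately show "\<exists>x'\<in>of_real ` {0<..}. x' \<noteq> 1 \<and> dist x' (1::complex) < e"
        using \<open>e > 0\<close> by (metis dist_self half_gt_zero less_irrefl field_sum_of_halves less_add_same_cancel1)
    qed
    show "D w = 0" if "w \<in> of_real ` {0<..}" for w
      using that fourier_gaussian_real_scale unfolding D_def by auto
  qed (use assms in \<open>auto simp: S_def\<close>)
  then show ?thesis by (simp add: D_def)
qed

lemma
  fixes z :: "'a::euclidean_space"
  assumes "0 < Re w"
  shows integrable_fourier_gaussian_euclidean: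
      "integrable lborel (\<lambda>x. cis (z \<bullet> x) * exp (- (w * (of_real (norm x))\<^sup>2)))" (is ?int)
    and fourier_gaussian_euclidean:
      "(LINT x|lborel. cis (z \<bullet> x) * exp (- (w * (of_real (norm x))\<^sup>2)))
        = csqrt (of_real pi / w) ^ DIM('a) * exp (- ((of_real (norm z))\<^sup>2 / (4 * w)))" (is ?val)
proof -
  have norm2: "complex_of_real (norm x) ^ 2 = (\<Sum>b\<in>Basis. (of_real (x \<bullet> b))\<^sup>2)" for x :: 'a
  proof -
    have "(norm x)\<^sup>2 = (\<Sum>b\<in>Basis. (x \<bullet> b)\<^sup>2)"
      unfolding power2_norm_eq_inner by (subst euclidean_inner) (simp add: power2_eq_square)
    then have "complex_of_real ((norm x)\<^sup>2) = of_real (\<Sum>b\<in>Basis. (x \<bullet> b)\<^sup>2)" by simp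
    then show ?thesis by simp
  qed
  have cis_sum: "cis (\<Sum>b\<in>B. t b) = (\<Prod>b\<in>B. cis (t b))" if "finite B" for t and B :: "'a set"
    using that by (induction B rule: finite_induct) (auto simp: cis_mult[symmetric])
  have eq: "(\<lambda>x. cis (z \<bullet> x) * exp (- (w * (of_real (norm x))\<^sup>2))) =
      (\<lambda>x. \<Prod>b\<in>Basis. cis ((z \<bullet> b) * (x \<bullet> b)) * exp (- (w * (of_real (x \<bullet> b))\<^sup>2)))"
  proof
    fix x :: 'a
    have "exp (- (w * (of_real (norm x))\<^sup>2)) = (\<Prod>b\<in>Basis. exp (- (w * (of_real (x \<bullet> b))\<^sup>2)))"
      by (simp add: norm2 exp_sum sum_distrib_left flip: sum_negf)
    moreover have "cis (z \<bullet> x) = (\<Prod>b\<in>Basis. cis ((z \<bullet> b) * (x \<bullet> b)))"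
      by (simp add: euclidean_inner[of z x] cis_sum)
    ultimately show "cis (z \<bullet> x) * exp (- (w * (of_real (norm x))\<^sup>2)) =
      (\<Prod>b\<in>Basis. cis ((z \<bullet> b) * (x \<bullet> b)) * exp (- (w * (of_real (x \<bullet> b))\<^sup>2)))"
      by (simp add: prod.distrib)
  qed
  show ?int
    unfolding eq by (intro integrable_lborel_prod_Basis integrable_fourier_gaussian assms)
  have "(LINT x|lborel. cis (z \<bullet> x) * exp (- (w * (of_real (norm x))\<^sup>2))) =
      (\<Prod>b\<in>Basis. csqrt (of_real pi / w) * exp (- ((of_real (z \<bullet> b))\<^sup>2 / (4 * w))))"
    unfolding eq using assms
    by (subst integral_lborel_prod_Basis)
      (simp_all add: integrable_fourier_gaussian fourier_gaussian_complex_scale)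
  also have "\<dots> = csqrt (of_real pi / w) ^ DIM('a) * exp (- ((of_real (norm z))\<^sup>2 / (4 * w)))"
    by (simp add: prod.distrib norm2 exp_sum sum_divide_distrib flip: sum_negf)
  finally show ?val .
qed

section \<open>Extrapolation from arithmetic progressions\<close>

text \<open>With \<open>z\<close> denoting the translation by \<open>h\<close>, this is the part of the binomial expansion of
  \<open>((1 - z) + z)\<^bsup>2 N - 1\<^esup>\<close> that contains fewer than \<open>N\<close> factors \<open>1 - z\<close>, with these factors
  multiplied out.  It equals the value at \<open>x\<close> of the polynomial of degree below \<open>N\<close> (along the line)
  that interpolates \<open>f\<close> at \<open>x + j h\<close> for \<open>N \<le> j < 2 N\<close>, but the double sum makes the size of the
  coefficients evident.\<close>

definition extrapolate :: "nat \<Rightarrow> ('a::real_vector \<Rightarrow> complex) \<Rightarrow> 'a \<Rightarrow> 'a \<Rightarrow> complex" where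
  "extrapolate N f x h = (\<Sum>i<N. \<Sum>l\<le>i.
     of_nat (((2 * N - 1) choose i) * (i choose l)) * (- 1) ^ l * f (x + real (2 * N - 1 - i + l) *\<^sub>R h))"

lemma four_times_two_power: "2 ^ (2 * N) * 2 ^ N = (8 :: 'a::comm_semiring_1) ^ N"
proof -
  have "2 ^ (2 * N) * 2 ^ N = (2 :: 'a) ^ (3 * N)" by (simp flip: power_add)
  also have "\<dots> = 8 ^ N" by (simp add: power_mult)
  finally show ?thesis .
qed

lemma sum_extrapolate_weights:
  "(\<Sum>i<N. \<Sum>l\<le>i. real (((2 * N - 1) choose i) * (i choose l))) \<le> 8 ^ N"
proof -
  have "(\<Sum>i<N. \<Sum>l\<le>i. ((2 * N - 1) choose i) * (i choose l)) = (\<Sum>i<N. ((2 * N - 1) choose i) * 2 ^ i)"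
    by (simp add: choose_row_sum flip: sum_distrib_left)
  also have "\<dots> \<le> (\<Sum>i<N. ((2 * N - 1) choose i) * 2 ^ N)"
    by (intro sum_mono mult_left_mono power_increasing) auto
  also have "\<dots> \<le> (\<Sum>i\<le>2 * N - 1. (2 * N - 1) choose i) * 2 ^ N"
    unfolding sum_distrib_right by (intro sum_mono2) auto
  also have "\<dots> = 2 ^ (2 * N - 1) * 2 ^ N"
    by (simp add: choose_row_sum)
  also have "\<dots> \<le> 2 ^ (2 * N) * 2 ^ N"
    by (intro mult_right_mono power_increasing) auto
  also have "\<dots> = 8 ^ N"
    by (rule four_times_two_power)
  finally show ?thesis
    using of_nat_le_iff[where ?'a = real, of "\<Sum>i<N. \<Sum>l\<le>i. ((2 * N - 1) choose i) * (i choose l)" "8 ^ N"]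
    by simp
qed

lemma extrapolate_norm_le:
  "cmod (extrapolate N f x h) \<le> (\<Sum>i<N. \<Sum>l\<le>i.
     real (((2 * N - 1) choose i) * (i choose l)) * cmod (f (x + real (2 * N - 1 - i + l) *\<^sub>R h)))"
  unfolding extrapolate_def
  by (intro order_trans[OF norm_sum] sum_mono) (simp add: norm_mult norm_power)

lemma extrapolate_le:
  assumes "\<And>j. N \<le> j \<Longrightarrow> j \<le> 2 * N \<Longrightarrow> cmod (f (x + real j *\<^sub>R h)) \<le> m" and "0 \<le> m"
  shows "cmod (extrapolate N f x h) \<le> 8 ^ N * m"
proof -
  have "cmod (extrapolate N f x h) \<le> (\<Sum>i<N. \<Sum>l\<le>i. real (((2 * N - 1) choose i) * (i choose l)) * m)"
    by (intro order_trans[OF extrapolate_norm_le] sum_mono mult_left_mono assms(1)) auto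
  also have "\<dots> = (\<Sum>i<N. \<Sum>l\<le>i. real (((2 * N - 1) choose i) * (i choose l))) * m"
    by (simp add: sum_distrib_right)
  also have "\<dots> \<le> 8 ^ N * m"
    by (intro mult_right_mono sum_extrapolate_weights assms(2))
  finally show ?thesis .
qed

text \<open>The difference consists of the terms of the expansion of \<open>((1 - \<zeta>) + \<zeta>)\<^bsup>2 N - 1\<^esup>\<close> with at
  least \<open>N\<close> factors \<open>1 - \<zeta>\<close>.  So extrapolation is exact to order \<open>N\<close> at \<open>\<zeta> = 1\<close>, which is low
  frequency when \<open>\<zeta>\<close> is the multiplier of a translation.\<close>

lemma extrapolation_symbol:
  fixes \<zeta> :: complex
  assumes "cmod \<zeta> \<le> 1" and "1 \<le> N"
  shows "cmod (1 - (\<Sum>i<N. \<Sum>l\<le>i. of_nat (((2 * N - 1) choose i) * (i choose l)) * (- 1) ^ l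
      * \<zeta> ^ (2 * N - 1 - i + l))) \<le> 8 ^ N * cmod (1 - \<zeta>) ^ N"
proof -
  define L where "L = 2 * N - 1"
  define t where "t i = of_nat (L choose i) * (1 - \<zeta>) ^ i * \<zeta> ^ (L - i)" for i
  have L: "N \<le> Suc L" using assms(2) by (simp add: L_def)
  have "(\<Sum>l\<le>i. of_nat ((L choose i) * (i choose l)) * (- 1) ^ l * \<zeta> ^ (L - i + l)) = t i" for i
  proof -
    have "(1 - \<zeta>) ^ i = (- \<zeta> + 1) ^ i" by simp
    also have "\<dots> = (\<Sum>l\<le>i. of_nat (i choose l) * (- \<zeta>) ^ l)"
      by (subst binomial_ring) simp
    finally show ?thesis
      unfolding t_def
      by (simp add: sum_distrib_left sum_distrib_right power_minus[of \<zeta>] power_add mult_ac)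
  qed
  then have "1 - (\<Sum>i<N. \<Sum>l\<le>i. of_nat ((L choose i) * (i choose l)) * (- 1) ^ l * \<zeta> ^ (L - i + l))
      = ((1 - \<zeta>) + \<zeta>) ^ L - (\<Sum>i<N. t i)" by simp
  also have "((1 - \<zeta>) + \<zeta>) ^ L = (\<Sum>i<Suc L. t i)"
    unfolding t_def by (subst binomial_ring) (simp add: lessThan_Suc_atMost)
  also have "\<dots> - (\<Sum>i<N. t i) = (\<Sum>i\<in>{N..<Suc L}. t i)"
    using sum_diff_nat_ivl[of 0 N "Suc L" t] L by (simp add: atLeast0LessThan)
  also have "cmod \<dots> \<le> (\<Sum>i\<in>{N..<Suc L}. real (L choose i) * 2 ^ N * cmod (1 - \<zeta>) ^ N)"
  proof (intro sum_norm_le)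
    fix i assume i: "i \<in> {N..<Suc L}"
    have 2: "cmod (1 - \<zeta>) \<le> 2"
      using norm_triangle_ineq4[of 1 \<zeta>] assms(1) by simp
    have "cmod (1 - \<zeta>) ^ i = cmod (1 - \<zeta>) ^ (i - N) * cmod (1 - \<zeta>) ^ N"
      using i by (simp flip: power_add)
    also have "\<dots> \<le> 2 ^ (i - N) * cmod (1 - \<zeta>) ^ N"
      by (intro mult_right_mono power_mono 2) auto
    also have "(2::real) ^ (i - N) \<le> 2 ^ N"
      using i by (intro power_increasing) (auto simp: L_def)
    finally have "cmod (1 - \<zeta>) ^ i \<le> 2 ^ N * cmod (1 - \<zeta>) ^ N"
      by (simp add: mult_right_mono)
    moreover have "cmod \<zeta> ^ (L - i) \<le> 1" using assms(1) by (simp add: power_le_one)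
    ultimately have "cmod (1 - \<zeta>) ^ i * cmod \<zeta> ^ (L - i) \<le> (2 ^ N * cmod (1 - \<zeta>) ^ N) * 1"
      by (intro mult_mono) auto
    then show "cmod (t i) \<le> real (L choose i) * 2 ^ N * cmod (1 - \<zeta>) ^ N"
      unfolding t_def by (simp add: norm_mult norm_power mult.assoc mult_left_mono)
  qed
  also have "\<dots> = (\<Sum>i\<in>{N..<Suc L}. real (L choose i)) * 2 ^ N * cmod (1 - \<zeta>) ^ N"
    by (simp only: sum_distrib_right mult.assoc)
  also have "(\<Sum>i\<in>{N..<Suc L}. real (L choose i)) \<le> (\<Sum>i\<le>L. real (L choose i))"
    by (intro sum_mono2) auto
  also have "\<dots> = 2 ^ L"
    using choose_row_sum[of L] by (metis of_nat_numeral of_nat_power of_nat_sum)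
  also have "(2::real) ^ L \<le> 2 ^ (2 * N)"
    by (intro power_increasing) (auto simp: L_def)
  also have "(2::real) ^ (2 * N) * 2 ^ N = 8 ^ N"
    by (rule four_times_two_power)
  finally show ?thesis
    by (simp add: L_def mult_right_mono)
qed

text \<open>The only trace of analyticity that the propagation argument uses.  Here \<open>d\<close> plays the role of
  a fraction of the width of the strip of analyticity, and \<open>M\<close> that of a bound in this strip.  The rate \<open>8\<^bsup>- N\<^esup>\<close>
  is the reciprocal of the amplification \<open>8\<^bsup>N\<^esup>\<close> that extrapolation itself can cause, so that both
  balance at the geometric mean.\<close>

definition extrapolable :: "real \<Rightarrow> real \<Rightarrow> ('a::real_normed_vector \<Rightarrow> complex) \<Rightarrow> bool" where
  "extrapolable d M f \<longleftrightarrow> (\<forall>x. cmod (f x) \<le> M) \<and>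
     (\<forall>N x h. 1 \<le> N \<longrightarrow> real N * norm h \<le> d \<longrightarrow> cmod (f x - extrapolate N f x h) \<le> M / 8 ^ N)"

lemma extrapolable_mono: "extrapolable d M f \<Longrightarrow> M \<le> M' \<Longrightarrow> extrapolable d M' f"
  unfolding extrapolable_def by (meson divide_right_mono order_trans zero_le_numeral zero_le_power)

text \<open>The two terms balance for \<open>64\<^bsup>N\<^esup>\<close> near \<open>M / m\<close>.  Rounding \<open>N\<close> down makes the first term at
  most \<open>\<surd>(m M)\<close> and the second at most \<open>8 \<surd>(m M)\<close>, hence the constant \<open>9\<close>.\<close>

lemma geometric_interpolation:
  fixes X m M :: real
  assumes "X \<le> M" "0 \<le> m" "0 \<le> M" and bd: "\<And>N. 1 \<le> N \<Longrightarrow> X \<le> 8 ^ N * m + M / 8 ^ N"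
  shows "X \<le> 9 * sqrt (m * M)"
proof -
  consider "X \<le> 0" | "0 < X" "m = 0" | "0 < X" "0 < m" using assms(2) by linarith
  then show ?thesis
  proof cases
    case 1
    moreover have "0 \<le> sqrt (m * M)" using assms(2,3) by simp
    ultimately show ?thesis by linarith
  next
    case 2
    obtain N where N: "M / X < 8 ^ N" using real_arch_pow[of 8 "M / X"] by auto
    also have "(8::real) ^ N \<le> 8 ^ Suc N" by simp
    finally have "M / 8 ^ Suc N < X" using 2 by (simp add: field_simps)
    with bd[of "Suc N"] 2 show ?thesis by simp
  next
    case 3
    have ex: "\<exists>n. M < m * 64 ^ Suc n"
    proof -
      obtain n where "M / m < 64 ^ n" using real_arch_pow[of 64 "M / m"] by auto
      also have "(64::real) ^ n \<le> 64 ^ Suc n" by simp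
      finally show ?thesis using 3 by (auto simp: field_simps)
    qed
    \<comment> \<open>The integer part of the logarithm of \<open>M / m\<close> to base 64, or 0 if this is negative.\<close>
    define N where "N = (LEAST n. M < m * 64 ^ Suc n)"
    have up: "M < m * 64 ^ Suc N" unfolding N_def using ex by (rule LeastI_ex)
    have M: "0 < M" using 3 assms(1) by linarith
    show ?thesis
    proof (cases N)
      \<comment> \<open>Extrapolation needs \<open>N \<ge> 1\<close>; here \<open>M < 64 m\<close>, so the bound \<open>X \<le> M\<close> suffices.\<close>
      case 0
      then have "M\<^sup>2 \<le> 64 * (m * M)" using up M by (simp add: power2_eq_square)
      then have "M \<le> sqrt (64 * (m * M))" by (rule real_le_rsqrt)
      also have "\<dots> = 8 * sqrt (m * M)" by (simp add: real_sqrt_mult)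
      finally show ?thesis using assms(1) 3 M by (smt (verit) real_sqrt_ge_zero mult_nonneg_nonneg)
    next
      case (Suc n)
      then have low: "m * 64 ^ N \<le> M"
        using not_less_Least[of n "\<lambda>n. M < m * 64 ^ Suc n"] by (simp add: N_def)
      have e: "(8 ^ N)\<^sup>2 = (64::real) ^ N" by (simp add: power2_eq_square flip: power_mult_distrib)
      have "(8 ^ N * m)\<^sup>2 \<le> m * M"
        using low 3 by (simp add: power_mult_distrib e power2_eq_square[of m] mult.left_commute mult.commute)
      then have 1: "8 ^ N * m \<le> sqrt (m * M)" by (rule real_le_rsqrt)
      have "(M / 8 ^ N)\<^sup>2 \<le> 64 * (m * M)"
        using up M by (simp add: power_divide e power2_eq_square[of M] field_simps)
      then have "M / 8 ^ N \<le> sqrt (64 * (m * M))" by (rule real_le_rsqrt)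
      then have "M / 8 ^ N \<le> 8 * sqrt (m * M)" by (simp add: real_sqrt_mult)
      with 1 bd[of N] Suc show ?thesis by simp
    qed
  qed
qed

section \<open>Propagation of smallness\<close>

text \<open>A point at distance between \<open>R\<close> and \<open>R + d\<close> from the centre is reached by extrapolating
  along the radius: the nodes lie at distance between \<open>d\<close> and \<open>2 d\<close> from it towards the centre, hence in the
  ball where \<open>f\<close> is small.  This is where \<open>d \<le> R\<close> enters, as the nodes may pass the centre.\<close>

lemma extrapolable_enlarge_ball:
  fixes f :: "'a::real_normed_vector \<Rightarrow> complex"
  assumes ext: "extrapolable d M f" and "0 < d" "d \<le> R"
    and m: "\<And>x. dist z x \<le> R \<Longrightarrow> cmod (f x) \<le> m"
    and y: "dist z y \<le> R + d"
  shows "cmod (f y) \<le> 9 * sqrt (m * M)"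
proof -
  have fM: "cmod (f x) \<le> M" for x using ext by (auto simp: extrapolable_def)
  have M: "0 \<le> M" using fM norm_ge_zero by (rule order_trans[rotated])
  have m0: "0 \<le> m" using m[of z] \<open>0 < d\<close> \<open>d \<le> R\<close> norm_ge_zero[of "f z"]
    by (simp del: norm_ge_zero)
  have "cmod (f y) \<le> 8 ^ N * m + M / 8 ^ N" if N: "1 \<le> N" for N
  proof (cases "dist z y \<le> R")
    case True
    have "1 * m \<le> 8 ^ N * m" using m0 by (intro mult_right_mono) auto
    then have "cmod (f y) \<le> 8 ^ N * m" using m[OF True] by simp
    moreover have "0 \<le> M / 8 ^ N" using M by simp
    ultimately show ?thesis by linarith
  next
    case False
    define D where "D = norm (y - z)"
    have D: "R < D" "D \<le> R + d" using False y by (auto simp: D_def dist_norm norm_minus_commute)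
    then have D0: "0 < D" using assms(2,3) by linarith
    define h where "h = (d / (real N * D)) *\<^sub>R (z - y)"
    have "real N * norm h = d"
      using N D0 \<open>0 < d\<close> by (simp add: h_def D_def norm_minus_commute)
    then have "cmod (f y - extrapolate N f y h) \<le> M / 8 ^ N"
      using ext N by (auto simp: extrapolable_def)
    moreover have "cmod (extrapolate N f y h) \<le> 8 ^ N * m"
    proof (rule extrapolate_le[OF m m0])
      fix j assume j: "N \<le> j" "j \<le> 2 * N"
      define t where "t = real j * d / real N"
      have "d \<le> t" "t \<le> 2 * d"
        using j N \<open>0 < d\<close> unfolding t_def by (simp_all add: field_simps)
      then have t: "\<bar>D - t\<bar> \<le> R" using D assms(2,3) by linarith
      have "y + real j *\<^sub>R h - z = (1 - t / D) *\<^sub>R (y - z)"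
        by (simp add: h_def t_def algebra_simps)
      then have "dist z (y + real j *\<^sub>R h) = \<bar>1 - t / D\<bar> * D"
        by (metis D_def dist_commute dist_norm norm_scaleR)
      also have "\<dots> = \<bar>(1 - t / D) * D\<bar>"
        using D0 by (simp add: abs_mult)
      also have "(1 - t / D) * D = D - t"
        using D0 by (simp add: field_simps)
      finally show "dist z (y + real j *\<^sub>R h) \<le> R" using t by simp
    qed
    ultimately show ?thesis
      using norm_triangle_ineq2[of "f y" "extrapolate N f y h"] by linarith
  qed
  then show ?thesis using geometric_interpolation[OF fM m0 M] by blast
qed

text \<open>In terms of \<open>m / (81 M)\<close> the passage from \<open>m\<close> to \<open>9 \<surd>(m M)\<close> is precisely the square root, so no
  constant accumulates in the iteration.\<close>

lemma extrapolable_iterate: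
  fixes f :: "'a::real_normed_vector \<Rightarrow> complex"
  assumes ext: "extrapolable d M f" and "0 < d" "0 < M" "0 \<le> \<mu>"
    and start: "\<And>x. dist z x \<le> d \<Longrightarrow> cmod (f x) \<le> 9 * sqrt (\<mu> * M)"
    and y: "dist z y \<le> real (Suc k) * d"
  shows "cmod (f y) \<le> 81 * M * (\<mu> / (81 * M)) powr (1/2) ^ Suc k"
  using y
proof (induction k arbitrary: y)
  case 0
  have "9 * sqrt (\<mu> * M) = 81 * M * sqrt (\<mu> / (81 * M))"
  proof (rule power2_eq_imp_eq)
    show "(9 * sqrt (\<mu> * M))\<^sup>2 = (81 * M * sqrt (\<mu> / (81 * M)))\<^sup>2"
      using assms(3,4) by (simp add: power_mult_distrib power2_eq_square[of M])
  qed (use assms(3,4) in auto)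
  then show ?case
    using start[of y] 0 assms(3,4) by (simp add: powr_half_sqrt)
next
  case (Suc k)
  define \<beta> where "\<beta> = \<mu> / (81 * M)"
  have "cmod (f y) \<le> 9 * sqrt ((81 * M * \<beta> powr (1/2) ^ Suc k) * M)"
  proof (rule extrapolable_enlarge_ball[OF ext \<open>0 < d\<close>, where R = "real (Suc k) * d"])
    show "d \<le> real (Suc k) * d" using \<open>0 < d\<close> by simp
    show "dist z y \<le> real (Suc k) * d + d" using Suc.prems by (simp add: algebra_simps)
  qed (use Suc.IH \<beta>_def in auto)
  also have "\<dots> = 81 * M * sqrt (\<beta> powr (1/2) ^ Suc k)"
  proof (rule power2_eq_imp_eq)
    show "(9 * sqrt ((81 * M * \<beta> powr (1/2) ^ Suc k) * M))\<^sup>2 = (81 * M * sqrt (\<beta> powr (1/2) ^ Suc k))\<^sup>2"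
      using assms(3) by (simp add: power_mult_distrib power2_eq_square[of M])
  qed (use assms(3) in auto)
  also have "sqrt (\<beta> powr (1/2) ^ Suc k) = (\<beta> powr (1/2) ^ Suc k) powr (1/2)"
    by (simp only: powr_half_sqrt powr_ge_zero)
  also have "\<dots> = \<beta> powr (1/2) ^ Suc (Suc k)"
    by (simp add: powr_powr)
  finally show ?case by (simp only: \<beta>_def)
qed

text \<open>The extrapolation estimate is averaged over all steps \<open>h\<close> in the ball of radius \<open>d / N\<close>.
  For each node the mean of \<open>|f (x + j h)|\<close> is the mean of \<open>|f|\<close> over the ball of radius \<open>j d / N\<close>
  around \<open>x\<close>; since \<open>N \<le> j \<le> 2 N\<close>, this ball has at least the volume of a ball of radius \<open>d\<close> and
  is contained in the ball of radius \<open>3 d\<close> around \<open>z\<close>.\<close>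

lemma extrapolable_mean_value:
  fixes f :: "'a::euclidean_space \<Rightarrow> complex"
  assumes ext: "extrapolable d M f" and "0 < d" and cont: "continuous_on UNIV f"
    and x: "dist z x \<le> d" and N: "1 \<le> N"
  shows "cmod (f x) \<le> 8 ^ N * ((LINT y:cball z (3 * d)|lborel. cmod (f y)) / (unit_ball_vol DIM('a) * d ^ DIM('a)))
     + M / 8 ^ N"
proof -
  define n where "n = DIM('a)"
  define J where "J = (LINT y:cball z (3 * d)|lborel. cmod (f y))"
  define B where "B = cball (0::'a) (d / real N)"
  define w where "w i l = real (((2 * N - 1) choose i) * (i choose l))" for i l
  have cf: "continuous_on UNIV (\<lambda>y. cmod (f y))" by (intro continuous_intros cont)
  have [measurable]: "(\<lambda>y. cmod (f y)) \<in> borel_measurable borel"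
    using cf by (rule borel_measurable_continuous_onI)
  have J0: "0 \<le> J" unfolding J_def set_lebesgue_integral_def by (intro integral_nonneg_AE) auto
  have vol: "measure lborel B = unit_ball_vol n * (d / real N) ^ n"
    unfolding B_def n_def using \<open>0 < d\<close> by (intro content_cball) auto
  have intB: "set_integrable lborel B (\<lambda>h. cmod (f (x + c *\<^sub>R h)))" for c
    unfolding B_def
    by (intro set_integrable_cball_continuous continuous_on_compose2[OF cf] continuous_intros) auto
  have shift: "(LINT h:B|lborel. cmod (f (x + real j *\<^sub>R h))) \<le> J / real N ^ n"
    if j: "N \<le> j" "j \<le> 2 * N" for j
  proof -
    have jpos: "0 < real j" using j N by linarith
    have "(LINT y:cball x (real j * (d / real N))|lborel. cmod (f y)) \<le> J"
      unfolding J_def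
    proof (rule set_integral_cball_mono[OF cf norm_ge_zero])
      have "real j * (d / real N) \<le> 2 * d"
        using j N \<open>0 < d\<close> by (simp add: field_simps)
      then show "cball x (real j * (d / real N)) \<subseteq> cball z (3 * d)"
        using x unfolding cball_subset_cball_iff by (simp add: dist_commute)
    qed
    then have "real j ^ n * (LINT h:B|lborel. cmod (f (x + real j *\<^sub>R h))) \<le> J"
      unfolding B_def n_def by (subst integral_cball_affine[symmetric]) (use jpos in auto)
    moreover have "real N ^ n * (LINT h:B|lborel. cmod (f (x + real j *\<^sub>R h)))
        \<le> real j ^ n * (LINT h:B|lborel. cmod (f (x + real j *\<^sub>R h)))"
    proof (intro mult_right_mono power_mono)
      show "0 \<le> (LINT h:B|lborel. cmod (f (x + real j *\<^sub>R h)))"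
        unfolding set_lebesgue_integral_def by (intro integral_nonneg_AE) auto
    qed (use j in auto)
    ultimately show ?thesis using N by (simp add: field_simps)
  qed
  define G where "G c h = indicator B h *\<^sub>R cmod (f (x + c *\<^sub>R h))" for c h
  have intG: "integrable lborel (G c)" for c
    using intB[of c] by (simp only: set_integrable_def G_def[abs_def])
  have sum_eq: "indicator B h *\<^sub>R (\<Sum>i<N. \<Sum>l\<le>i. w i l * cmod (f (x + real (2 * N - 1 - i + l) *\<^sub>R h)))
      = (\<Sum>i<N. \<Sum>l\<le>i. w i l * G (real (2 * N - 1 - i + l)) h)" for h
    by (simp add: G_def sum_distrib_left mult.left_commute)
  have "measure lborel B * (cmod (f x) - M / 8 ^ N) = (LINT h:B|lborel. cmod (f x) - M / 8 ^ N)"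
    using integrable_indicator_cball[of "0::'a" "d / real N"]
    by (simp add: B_def set_lebesgue_integral_def)
  also have "\<dots> \<le> (LINT h:B|lborel. (\<Sum>i<N. \<Sum>l\<le>i. w i l * cmod (f (x + real (2 * N - 1 - i + l) *\<^sub>R h))))"
  proof (rule set_integral_mono)
    show "set_integrable lborel B (\<lambda>h. cmod (f x) - M / 8 ^ N)"
      unfolding B_def by (rule set_integrable_cball_continuous) auto
    show "set_integrable lborel B (\<lambda>h. \<Sum>i<N. \<Sum>l\<le>i. w i l * cmod (f (x + real (2 * N - 1 - i + l) *\<^sub>R h)))"
      unfolding set_integrable_def sum_eq
      by (intro Bochner_Integration.integrable_sum integrable_mult_right intG)
    fix h assume "h \<in> B"
    then have "real N * norm h \<le> d" using N by (simp add: B_def field_simps)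
    then have "cmod (f x - extrapolate N f x h) \<le> M / 8 ^ N"
      using ext N by (auto simp: extrapolable_def)
    then show "cmod (f x) - M / 8 ^ N \<le> (\<Sum>i<N. \<Sum>l\<le>i. w i l * cmod (f (x + real (2 * N - 1 - i + l) *\<^sub>R h)))"
      using norm_triangle_ineq2[of "f x" "extrapolate N f x h"] extrapolate_norm_le[of N f x h]
      unfolding w_def by linarith
  qed
  also have "\<dots> = (\<Sum>i<N. \<Sum>l\<le>i. w i l * (LINT h:B|lborel. cmod (f (x + real (2 * N - 1 - i + l) *\<^sub>R h))))"
    unfolding set_lebesgue_integral_def sum_eq
    unfolding G_def[symmetric] by (simp add: Bochner_Integration.integral_sum intG)
  also have "\<dots> \<le> (\<Sum>i<N. \<Sum>l\<le>i. w i l * (J / real N ^ n))"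
    by (intro sum_mono mult_left_mono shift) (auto simp: w_def)
  also have "\<dots> = (\<Sum>i<N. \<Sum>l\<le>i. w i l) * (J / real N ^ n)"
    by (simp only: sum_distrib_right)
  also have "\<dots> \<le> 8 ^ N * (J / real N ^ n)"
    unfolding w_def using J0 by (intro mult_right_mono sum_extrapolate_weights) auto
  finally have "unit_ball_vol n * d ^ n * (cmod (f x) - M / 8 ^ N) \<le> 8 ^ N * J"
    using N by (simp add: vol power_divide divide_le_cancel)
  then have "cmod (f x) - M / 8 ^ N \<le> 8 ^ N * J / (unit_ball_vol n * d ^ n)"
    using \<open>0 < d\<close> by (subst pos_le_divide_eq) (auto simp: mult.commute)
  then show ?thesis by (simp add: J_def n_def)
qed

text \<open>\<open>\<mu>\<close> bounds the mean of \<open>|f|\<close> over the ball of radius \<open>3 d\<close>, relative to the volume of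
  a ball of radius \<open>d\<close>.  One interpolation converts it to a supremum over the ball of radius \<open>d\<close>, and each
  further one enlarges the radius by \<open>d\<close>.\<close>

theorem extrapolable_propagation_of_smallness:
  fixes f :: "'a::euclidean_space \<Rightarrow> complex"
  assumes ext: "extrapolable d M f" and "0 < d" "0 < M" and cont: "continuous_on UNIV f"
    and r: "3 * d \<le> r" and y: "dist z y \<le> real (Suc k) * d"
  defines "\<mu> \<equiv> sqrt (3 ^ DIM('a) / (unit_ball_vol DIM('a) * d ^ DIM('a))
      * (LINT x:cball z r|lborel. (cmod (f x))\<^sup>2))"
  shows "cmod (f y) \<le> 81 * M * (\<mu> / (81 * M)) powr (1/2) ^ Suc k"
proof -
  define n where "n = DIM('a)"
  define V where "V = unit_ball_vol n * d ^ n"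
  define B where "B = cball z (3 * d)"
  define I where "I = (LINT x:cball z r|lborel. (cmod (f x))\<^sup>2)"
  define J where "J = (LINT x:B|lborel. cmod (f x))"
  have V: "0 < V" using \<open>0 < d\<close> by (simp add: V_def)
  have cf: "continuous_on UNIV (\<lambda>y. cmod (f y))" "continuous_on UNIV (\<lambda>y. (cmod (f y))\<^sup>2)"
    by (intro continuous_intros cont)+
  have [measurable]: "(\<lambda>y. cmod (f y)) \<in> borel_measurable borel"
    using cf(1) by (rule borel_measurable_continuous_onI)
  have I0: "0 \<le> I" unfolding I_def set_lebesgue_integral_def by (intro integral_nonneg_AE) auto
  have "J\<^sup>2 \<le> (LINT x|lborel. (indicator B x)\<^sup>2) * (LINT x|lborel. (indicator B x * cmod (f x))\<^sup>2)"
  proof -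
    have "J = (LINT x|lborel. indicator B x * (indicator B x * cmod (f x)))"
      unfolding J_def set_lebesgue_integral_def
      by (intro Bochner_Integration.integral_cong) (auto simp: indicator_def)
    moreover have "(\<lambda>x. (indicator B x * cmod (f x))\<^sup>2) = (\<lambda>x. indicator B x *\<^sub>R (cmod (f x))\<^sup>2)"
      by (auto simp: indicator_def)
    moreover have "(\<lambda>x. (indicator B x)\<^sup>2) = (\<lambda>x. indicator B x :: real)"
      by (auto simp: indicator_def)
    moreover have "integrable lborel (\<lambda>x. indicator B x *\<^sub>R (cmod (f x))\<^sup>2)"
      using set_integrable_cball_continuous[OF cf(2)] by (simp add: B_def set_integrable_def)
    moreover have "integrable lborel (indicator B :: 'a \<Rightarrow> real)"
      unfolding B_def by (rule integrable_indicator_cball)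
    ultimately show ?thesis
      using integral_Cauchy_Schwarz[of "indicator B" lborel "\<lambda>x. indicator B x * cmod (f x)"]
      by (simp add: B_def)
  qed
  also have "(\<lambda>x. (indicator B x)\<^sup>2) = (\<lambda>x. indicator B x :: real)"
    by (auto simp: indicator_def)
  also have "(\<lambda>x. (indicator B x * cmod (f x))\<^sup>2) = (\<lambda>x. indicator B x *\<^sub>R (cmod (f x))\<^sup>2)"
    by (auto simp: indicator_def)
  also have "(LINT x|lborel. indicator B x) = 3 ^ n * V"
    using \<open>0 < d\<close> content_cball[of "3 * d" z] by (simp add: B_def V_def n_def power_mult_distrib)
  also have "(LINT x|lborel. indicator B x *\<^sub>R (cmod (f x))\<^sup>2) \<le> I"
    unfolding I_def set_lebesgue_integral_def[symmetric] B_def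
    using r by (intro set_integral_cball_mono[OF cf(2)]) auto
  finally have J2: "J\<^sup>2 \<le> 3 ^ n * V * I" using V by (simp add: mult_left_mono)
  have "\<mu> = sqrt (3 ^ n / V * I)" by (simp add: \<mu>_def V_def n_def I_def)
  moreover have "(J / V)\<^sup>2 \<le> 3 ^ n / V * I"
    using J2 V by (simp add: power_divide power2_eq_square[of V] field_simps)
  ultimately have J\<mu>: "J / V \<le> \<mu>" by (simp add: real_le_rsqrt)
  have \<mu>0: "0 \<le> \<mu>" using V I0 by (simp add: \<mu>_def I_def V_def n_def)
  show ?thesis
  proof (rule extrapolable_iterate[OF ext \<open>0 < d\<close> \<open>0 < M\<close> \<mu>0 _ y])
    fix x assume x: "dist z x \<le> d"
    show "cmod (f x) \<le> 9 * sqrt (\<mu> * M)"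
    proof (rule geometric_interpolation[OF _ \<mu>0])
      fix N :: nat assume "1 \<le> N"
      then have "cmod (f x) \<le> 8 ^ N * (J / V) + M / 8 ^ N"
        unfolding J_def V_def B_def n_def
        by (intro extrapolable_mean_value ext \<open>0 < d\<close> cont x)
      also have "8 ^ N * (J / V) \<le> 8 ^ N * \<mu>" using J\<mu> by (intro mult_left_mono) auto
      finally show "cmod (f x) \<le> 8 ^ N * \<mu> + M / 8 ^ N" by simp
    qed (use ext \<open>0 < M\<close> in \<open>auto simp: extrapolable_def\<close>)
  qed
qed

section \<open>The free Schroedinger evolution as a Fourier integral\<close>

text \<open>The multiplier \<open>exp (- \<i> T |\<xi>|\<^sup>2)\<close> is not integrable, so the order of integration cannot be
  exchanged directly.  Replacing \<open>\<i> T\<close> by \<open>w = 1 / (k + 1) + \<i> T\<close> makes it a Gaussian, for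
  which Fubini and the Gaussian transform apply; letting \<open>k\<close> tend to infinity is justified by dominated
  convergence on both sides, with majorants \<open>|fourier_transform u0|\<close> and \<open>|u0|\<close>.  Expanding
  \<open>|x - y|\<^sup>2\<close> then splits off a phase that depends only on \<open>x\<close>.  Only absolute values are compared, so the phase
  of the Gaussian normalisation disappears as well.\<close>

lemma norm_schrodinger_eq_chirp_fourier:
  fixes u0 :: "'a::euclidean_space \<Rightarrow> complex"
  assumes u0: "integrable lborel u0" and ft: "integrable lborel (fourier_transform u0)" and T: "0 < T"
  shows "cmod (schrodinger T u0 x) = sqrt (1 / (4 * pi * T)) ^ DIM('a) *
    cmod (LINT y|lborel. cis (- 1 / (2 * T) * (x \<bullet> y)) * (cis ((norm y)\<^sup>2 / (4 * T)) * u0 y))"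
proof -
  define n where "n = DIM('a)"
  define \<kappa> where "\<kappa> = sqrt (1 / (2 * pi)) ^ n"
  have \<kappa>: "(2 * pi) powr (- real DIM('a) / 2) = \<kappa>"
  proof -
    have "\<kappa> = ((1 / (2 * pi)) powr (1/2)) powr real n"
      by (simp add: \<kappa>_def powr_half_sqrt powr_realpow)
    also have "\<dots> = (2 * pi) powr (- real DIM('a) / 2)"
      by (simp add: powr_powr powr_divide powr_minus_divide n_def)
    finally show ?thesis by simp
  qed
  have \<kappa>0: "0 < \<kappa>" by (simp add: \<kappa>_def)
  have [measurable]: "u0 \<in> borel_measurable borel" "fourier_transform u0 \<in> borel_measurable borel"
    using u0 ft by auto
  define w where "w k = Complex (1 / real (Suc k)) T" for k
  have w: "0 < Re (w k)" for k by (simp add: w_def)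
  have w_lim: "w \<longlonglongrightarrow> Complex 0 T"
    unfolding w_def using LIMSEQ_inverse_real_of_nat
    by (intro tendsto_Complex tendsto_const) (simp add: inverse_eq_divide)
  define \<Phi> where "\<Phi> k = (LINT \<xi>|lborel. cis (x \<bullet> \<xi>) * (exp (- (w k * (of_real (norm \<xi>))\<^sup>2)) * fourier_transform u0 \<xi>))" for k
  have "\<Phi> \<longlonglongrightarrow> (LINT \<xi>|lborel. cis (x \<bullet> \<xi>) * (cis (- (T * (norm \<xi>)\<^sup>2)) * fourier_transform u0 \<xi>))"
    unfolding \<Phi>_def
  proof (rule integral_dominated_convergence[OF _ _ integrable_norm[OF ft]])
    have "exp (- (Complex 0 T * (of_real (norm \<xi>))\<^sup>2)) = cis (- (T * (norm \<xi>)\<^sup>2))" for \<xi> :: 'a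
      by (simp add: cis_conv_exp Complex_eq mult_ac)
    then show "AE \<xi> in lborel. (\<lambda>k. cis (x \<bullet> \<xi>) * (exp (- (w k * (of_real (norm \<xi>))\<^sup>2)) * fourier_transform u0 \<xi>))
        \<longlonglongrightarrow> cis (x \<bullet> \<xi>) * (cis (- (T * (norm \<xi>)\<^sup>2)) * fourier_transform u0 \<xi>)"
      by (intro AE_I2 tendsto_intros) (metis tendsto_exp tendsto_minus tendsto_mult_right w_lim)
    show "AE \<xi> in lborel. norm (cis (x \<bullet> \<xi>) * (exp (- (w k * (of_real (norm \<xi>))\<^sup>2)) * fourier_transform u0 \<xi>))
        \<le> norm (fourier_transform u0 \<xi>)" for k
      using w[of k] by (intro AE_I2) (auto simp: norm_mult intro!: mult_left_le_one_le)
  qed measurable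
  then have lim1: "(\<lambda>k. \<kappa> * cmod (\<Phi> k)) \<longlonglongrightarrow> cmod (schrodinger T u0 x)"
    unfolding schrodinger_def \<kappa> using \<kappa>0 by (auto intro!: tendsto_intros)
  have \<Phi>_eq: "cmod (\<Phi> k) = \<kappa> * (sqrt (pi / cmod (w k)) ^ n *
      cmod (LINT y|lborel. u0 y * exp (- ((of_real (norm (x - y)))\<^sup>2 / (4 * w k)))))" for k
  proof -
    define F where "F \<xi> y = cis ((x - y) \<bullet> \<xi>) * exp (- (w k * (of_real (norm \<xi>))\<^sup>2)) * u0 y" for \<xi> y
    have gauss: "integrable lborel (\<lambda>\<xi>::'a. exp (- (Re (w k) * (norm \<xi>)\<^sup>2)))"
      using integrable_norm[OF integrable_fourier_gaussian_euclidean[OF w[of k], of "0::'a"]]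
      by (simp add: norm_mult)
    have normF: "cmod (F \<xi> y) = exp (- (Re (w k) * (norm \<xi>)\<^sup>2)) * cmod (u0 y)" for \<xi> y
      by (simp add: F_def norm_mult)
    have [measurable]: "(\<lambda>(\<xi>, y). F \<xi> y) \<in> borel_measurable (lborel \<Otimes>\<^sub>M lborel)"
      unfolding F_def by measurable
    have intF: "integrable (lborel \<Otimes>\<^sub>M lborel) (\<lambda>(\<xi>, y). F \<xi> y)"
    proof (rule lborel_pair.Fubini_integrable)
      show "integrable lborel (\<lambda>\<xi>. LINT y|lborel. norm (case (\<xi>, y) of (\<xi>, y) \<Rightarrow> F \<xi> y))"
        using gauss by (simp add: normF)
      have "integrable lborel (\<lambda>y. F \<xi> y)" for \<xi>
      proof (rule Bochner_Integration.integrable_bound)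
        show "integrable lborel (\<lambda>y. exp (- (Re (w k) * (norm \<xi>)\<^sup>2)) * cmod (u0 y))"
          using u0 by auto
        show "AE y in lborel. norm (F \<xi> y) \<le> norm (exp (- (Re (w k) * (norm \<xi>)\<^sup>2)) * cmod (u0 y))"
          by (simp add: normF)
      qed (auto simp: F_def)
      then show "AE \<xi> in lborel. integrable lborel (\<lambda>y. case (\<xi>, y) of (\<xi>, y) \<Rightarrow> F \<xi> y)"
        by simp
    qed measurable
    have "\<Phi> k = (LINT \<xi>|lborel. of_real \<kappa> * (LINT y|lborel. F \<xi> y))"
      unfolding \<Phi>_def
    proof (intro Bochner_Integration.integral_cong refl)
      fix \<xi> :: 'a
      have "cis ((x - y) \<bullet> \<xi>) = cis (x \<bullet> \<xi>) * cis (- (y \<bullet> \<xi>))" for y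
        by (simp add: inner_diff_left cis_mult)
      then have "(LINT y|lborel. F \<xi> y) = (LINT y|lborel. (cis (x \<bullet> \<xi>) * exp (- (w k * (of_real (norm \<xi>))\<^sup>2))) * (cis (- (y \<bullet> \<xi>)) * u0 y))"
        by (simp only: F_def mult_ac)
      also have "\<dots> = (cis (x \<bullet> \<xi>) * exp (- (w k * (of_real (norm \<xi>))\<^sup>2))) * (LINT y|lborel. cis (- (y \<bullet> \<xi>)) * u0 y)"
        by (rule integral_mult_right_zero)
      finally show "cis (x \<bullet> \<xi>) * (exp (- (w k * (of_real (norm \<xi>))\<^sup>2)) * fourier_transform u0 \<xi>)
          = of_real \<kappa> * (LINT y|lborel. F \<xi> y)"
        unfolding fourier_transform_def \<kappa> scaleR_conv_of_real by (simp only: mult_ac)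
    qed
    also have "\<dots> = of_real \<kappa> * (LINT \<xi>|lborel. LINT y|lborel. F \<xi> y)"
      by (rule integral_mult_right_zero)
    also have "(LINT \<xi>|lborel. LINT y|lborel. F \<xi> y) = (LINT y|lborel. LINT \<xi>|lborel. F \<xi> y)"
      using lborel_pair.Fubini_integral[OF intF] by simp
    also have "(\<lambda>y. LINT \<xi>|lborel. F \<xi> y) = (\<lambda>y. csqrt (of_real pi / w k) ^ n *
        (u0 y * exp (- ((of_real (norm (x - y)))\<^sup>2 / (4 * w k)))))"
      unfolding F_def integral_mult_left_zero fourier_gaussian_euclidean[OF w] n_def
      by (simp only: mult_ac)
    also have "(LINT y|lborel. csqrt (of_real pi / w k) ^ n * (u0 y * exp (- ((of_real (norm (x - y)))\<^sup>2 / (4 * w k)))))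
        = csqrt (of_real pi / w k) ^ n * (LINT y|lborel. u0 y * exp (- ((of_real (norm (x - y)))\<^sup>2 / (4 * w k))))"
      by (rule integral_mult_right_zero)
    finally show ?thesis
      using \<kappa>0 by (simp add: norm_mult norm_power norm_divide)
  qed
  define L where "L = (LINT y|lborel. u0 y * cis ((norm (x - y))\<^sup>2 / (4 * T)))"
  have "(\<lambda>k. LINT y|lborel. u0 y * exp (- ((of_real (norm (x - y)))\<^sup>2 / (4 * w k)))) \<longlonglongrightarrow> L"
    unfolding L_def
  proof (rule integral_dominated_convergence[OF _ _ integrable_norm[OF u0]])
    have "- (c / (4 * Complex 0 T)) = \<i> * (c / (4 * of_real T))" for c
      using T by (simp add: Complex_eq divide_simps)
    then have "exp (- ((of_real (norm (x - y)))\<^sup>2 / (4 * Complex 0 T))) = cis ((norm (x - y))\<^sup>2 / (4 * T))" for y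
      by (simp add: cis_conv_exp)
    moreover have "(\<lambda>k. exp (- ((of_real (norm (x - y)))\<^sup>2 / (4 * w k))))
        \<longlonglongrightarrow> exp (- ((of_real (norm (x - y)))\<^sup>2 / (4 * Complex 0 T)))" for y
      using T by (intro tendsto_intros w_lim) (simp add: Complex_eq_0)
    ultimately show "AE y in lborel. (\<lambda>k. u0 y * exp (- ((of_real (norm (x - y)))\<^sup>2 / (4 * w k))))
        \<longlonglongrightarrow> u0 y * cis ((norm (x - y))\<^sup>2 / (4 * T))"
      by (intro AE_I2 tendsto_mult tendsto_const) simp
    have "0 \<le> Re (of_real c / (4 * w k))" if "0 \<le> c" for c k
    proof -
      have "0 \<le> Re (inverse (w k))" using w[of k] by simp
      then have "0 \<le> c / 4 * Re (inverse (w k))" using that by (intro mult_nonneg_nonneg) auto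
      also have "\<dots> = Re (of_real (c / 4) * inverse (w k))" by (simp del: inverse_complex.sel)
      also have "of_real (c / 4) * inverse (w k) = of_real c / (4 * w k)"
        by (simp add: field_simps)
      finally show ?thesis .
    qed
    from this[of "(norm (x - y))\<^sup>2" for y]
    have "0 \<le> Re ((of_real (norm (x - y)))\<^sup>2 / (4 * w k))" for k y
      by (simp only: of_real_power zero_le_power2)
    then show "AE y in lborel. norm (u0 y * exp (- ((of_real (norm (x - y)))\<^sup>2 / (4 * w k)))) \<le> norm (u0 y)" for k
      by (intro AE_I2) (simp only: norm_mult norm_exp_eq_Re uminus_complex.sel mult_right_le_one_le exp_ge_zero exp_le_one_iff neg_le_0_iff_le norm_ge_zero)
  qed measurable
  then have "(\<lambda>k. \<kappa> * cmod (\<Phi> k)) \<longlonglongrightarrow> \<kappa> * (\<kappa> * (sqrt (pi / cmod (Complex 0 T)) ^ n * cmod L))"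
    unfolding \<Phi>_eq using T by (intro tendsto_intros w_lim) (auto simp: Complex_eq_0)
  then have "cmod (schrodinger T u0 x) = \<kappa> * (\<kappa> * (sqrt (pi / cmod (Complex 0 T)) ^ n * cmod L))"
    by (rule LIMSEQ_unique[OF lim1])
  also have "\<dots> = sqrt (1 / (4 * pi * T)) ^ n * cmod L"
  proof -
    have "sqrt (1 / (2 * pi)) * sqrt (1 / (2 * pi)) * sqrt (pi / T) = sqrt (1 / (4 * pi * T))"
      using T by (rule_tac power2_eq_imp_eq) (auto simp: power_mult_distrib field_simps power2_eq_square)
    then have "\<kappa> * \<kappa> * sqrt (pi / T) ^ n = sqrt (1 / (4 * pi * T)) ^ n"
      unfolding \<kappa>_def power_mult_distrib[symmetric] by simp
    moreover have "cmod (Complex 0 T) = T" using T by (simp add: cmod_def)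
    ultimately show ?thesis by (simp flip: mult.assoc)
  qed
  also have "L = cis ((norm x)\<^sup>2 / (4 * T)) *
      (LINT y|lborel. cis (- 1 / (2 * T) * (x \<bullet> y)) * (cis ((norm y)\<^sup>2 / (4 * T)) * u0 y))"
    unfolding L_def integral_mult_right_zero[symmetric]
  proof (intro Bochner_Integration.integral_cong refl)
    fix y :: 'a
    have "(norm (x - y))\<^sup>2 = (norm x)\<^sup>2 - 2 * (x \<bullet> y) + (norm y)\<^sup>2"
      by (simp add: power2_norm_eq_inner inner_diff inner_commute)
    then have "(norm (x - y))\<^sup>2 / (4 * T) = (norm x)\<^sup>2 / (4 * T) + (- 1 / (2 * T) * (x \<bullet> y) + (norm y)\<^sup>2 / (4 * T))"
      using T by (simp add: field_simps)
    then show "u0 y * cis ((norm (x - y))\<^sup>2 / (4 * T)) = cis ((norm x)\<^sup>2 / (4 * T)) *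
        (cis (- 1 / (2 * T) * (x \<bullet> y)) * (cis ((norm y)\<^sup>2 / (4 * T)) * u0 y))"
      by (simp only: cis_mult[symmetric] mult_ac)
  qed
  finally show ?thesis by (simp add: norm_mult n_def)
qed

text \<open>The multiplier has absolute value one, so the integrand of the inverse transform is then not integrable
  either, and the Bochner integral takes its default value.  For test functions the situation
  does not occur; treating it as a trivial case replaces a proof of this fact.\<close>

lemma schrodinger_eq_0:
  fixes u0 :: "'a::euclidean_space \<Rightarrow> complex"
  assumes "\<not> integrable lborel (fourier_transform u0)"
  shows "schrodinger T u0 x = 0"
proof -
  have "\<not> integrable lborel (\<lambda>\<xi>. cis (x \<bullet> \<xi>) * (cis (- (T * (norm \<xi>)\<^sup>2)) * fourier_transform u0 \<xi>))" (is "\<not> integrable _ ?F")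
  proof
    assume i: "integrable lborel ?F"
    then have [measurable]: "?F \<in> borel_measurable borel" by auto
    have "integrable lborel (\<lambda>\<xi>. cis (- (x \<bullet> \<xi>)) * (cis (T * (norm \<xi>)\<^sup>2) * ?F \<xi>))"
      by (rule Bochner_Integration.integrable_bound[OF i]) (auto simp: norm_mult)
    moreover have "cis (- (x \<bullet> \<xi>)) * (cis (T * (norm \<xi>)\<^sup>2) * ?F \<xi>) = fourier_transform u0 \<xi>" for \<xi>
    proof -
      have "cis (- (x \<bullet> \<xi>)) * (cis (T * (norm \<xi>)\<^sup>2) * ?F \<xi>) =
        (cis (- (x \<bullet> \<xi>)) * cis (x \<bullet> \<xi>)) * (cis (T * (norm \<xi>)\<^sup>2) * cis (- (T * (norm \<xi>)\<^sup>2))) * fourier_transform u0 \<xi>"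
        by (simp only: mult_ac)
      then show ?thesis by (simp add: cis_mult)
    qed
    ultimately show False using assms by simp
  qed
  then show ?thesis by (simp add: schrodinger_def not_integrable_integral_eq)
qed

lemma norm_one_minus_cis_le: "cmod (1 - cis t) \<le> \<bar>t\<bar>"
  using iexp_approx1[of t 0] by (simp add: cis_conv_exp norm_minus_commute)

text \<open>On the frequency side extrapolation multiplies \<open>g y\<close> by a polynomial in
  \<open>\<zeta> = exp (\<i> s h \<bullet> y)\<close>, with \<open>|1 - \<zeta>| \<le> |s| |h| |y| \<le> b |y| / (64 N)\<close>.  By
  \<open>extrapolation_symbol\<close> the error is at most \<open>8\<^bsup>N\<^esup> (b |y| / (64 N))\<^bsup>N\<^esup> \<le> exp (b |y|) / 8\<^bsup>N\<^esup>\<close>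
  pointwise in \<open>y\<close>; the constant \<open>64\<close> is chosen for this.\<close>

lemma extrapolable_fourier_integral:
  fixes g :: "'a::euclidean_space \<Rightarrow> complex"
  assumes g: "integrable lborel g"
    and eg: "integrable lborel (\<lambda>y. exp (b * norm y) * cmod (g y))"
    and "0 < b" and sd: "\<bar>s\<bar> * d \<le> b / 64"
  shows "extrapolable d (LINT y|lborel. exp (b * norm y) * cmod (g y))
    (\<lambda>x. LINT y|lborel. cis (s * (x \<bullet> y)) * g y)"
proof -
  define M where "M = (LINT y|lborel. exp (b * norm y) * cmod (g y))"
  define f where "f x = (LINT y|lborel. cis (s * (x \<bullet> y)) * g y)" for x :: 'a
  have [measurable]: "g \<in> borel_measurable borel" using g by auto
  have cg: "integrable lborel (\<lambda>y. cis (s * (x \<bullet> y)) * g y)" for x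
    by (rule Bochner_Integration.integrable_bound[OF g]) (auto simp: norm_mult)
  have "cmod (f x) \<le> M" for x
    unfolding f_def M_def
  proof (rule Bochner_Integration.integral_norm_bound_integral[OF cg eg])
    show "cmod (cis (s * (x \<bullet> y)) * g y) \<le> exp (b * norm y) * cmod (g y)" for y
      using \<open>0 < b\<close> mult_right_mono[of 1 "exp (b * norm y)" "cmod (g y)"] by (simp add: norm_mult)
  qed
  moreover have "cmod (f x - extrapolate N f x h) \<le> M / 8 ^ N"
    if N: "1 \<le> N" and h: "real N * norm h \<le> d" for N x h
  proof -
    define c where "c i l = (of_nat (((2 * N - 1) choose i) * (i choose l)) * (- 1) ^ l :: complex)" for i l
    define \<zeta> where "\<zeta> y = cis (s * (h \<bullet> y))" for y
    define S where "S y = (\<Sum>i<N. \<Sum>l\<le>i. c i l * \<zeta> y ^ (2 * N - 1 - i + l))" for y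
    have shift: "cis (s * ((x + real j *\<^sub>R h) \<bullet> y)) = cis (s * (x \<bullet> y)) * \<zeta> y ^ j" for j y
      by (simp add: \<zeta>_def Complex.DeMoivre cis_mult inner_add_left algebra_simps)
    have "extrapolate N f x h = (LINT y|lborel. (\<Sum>i<N. \<Sum>l\<le>i. c i l *
        (cis (s * ((x + real (2 * N - 1 - i + l) *\<^sub>R h) \<bullet> y)) * g y)))"
      unfolding extrapolate_def f_def c_def
      by (subst Bochner_Integration.integral_sum)
        (auto intro!: Bochner_Integration.integrable_sum sum.cong cg
          simp: Bochner_Integration.integral_sum cg)
    also have "\<dots> = (LINT y|lborel. cis (s * (x \<bullet> y)) * S y * g y)"
      unfolding shift S_def by (simp add: sum_distrib_left sum_distrib_right mult_ac)
    finally have ext: "extrapolate N f x h = (LINT y|lborel. cis (s * (x \<bullet> y)) * S y * g y)" .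
    have intS: "integrable lborel (\<lambda>y. cis (s * (x \<bullet> y)) * S y * g y)"
    proof -
      have "(\<lambda>y. cis (s * (x \<bullet> y)) * S y * g y) = (\<lambda>y. \<Sum>i<N. \<Sum>l\<le>i. c i l *
        (cis (s * ((x + real (2 * N - 1 - i + l) *\<^sub>R h) \<bullet> y)) * g y))"
        unfolding shift S_def by (simp add: sum_distrib_left sum_distrib_right mult_ac)
      then show ?thesis
        by (auto intro!: Bochner_Integration.integrable_sum cg)
    qed
    have "f x - extrapolate N f x h
        = (LINT y|lborel. cis (s * (x \<bullet> y)) * g y - cis (s * (x \<bullet> y)) * S y * g y)"
      unfolding ext using intS cg by (simp add: f_def)
    also have "cmod \<dots> \<le> (LINT y|lborel. (exp (b * norm y) * cmod (g y)) / 8 ^ N)"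
    proof (rule Bochner_Integration.integral_norm_bound_integral)
      fix y :: 'a
      have "real N * \<bar>s * (h \<bullet> y)\<bar> \<le> \<bar>s\<bar> * (real N * norm h) * norm y"
        using Cauchy_Schwarz_ineq2[of h y]
        by (simp add: abs_mult mult_left_mono mult.assoc mult.left_commute)
      also have "\<dots> \<le> \<bar>s\<bar> * d * norm y"
        using h by (intro mult_right_mono mult_left_mono) auto
      also have "\<dots> \<le> b / 64 * norm y"
        using sd by (intro mult_right_mono) auto
      finally have "\<bar>s * (h \<bullet> y)\<bar> \<le> (b * norm y / real N) / 64"
        using N by (simp add: field_simps)
      also have "\<dots> \<le> exp (b * norm y / real N) / 64"
        by (intro divide_right_mono order_trans[OF _ exp_ge_add_one_self]) auto
      finally have "cmod (1 - \<zeta> y) \<le> exp (b * norm y / real N) / 64"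
        unfolding \<zeta>_def by (rule order_trans[OF norm_one_minus_cis_le])
      then have "cmod (1 - \<zeta> y) ^ N \<le> (exp (b * norm y / real N) / 64) ^ N"
        by (intro power_mono) auto
      also have "\<dots> = exp (b * norm y) / 64 ^ N"
        using N by (simp add: power_divide flip: exp_of_nat_mult)
      finally have "8 ^ N * cmod (1 - \<zeta> y) ^ N \<le> 8 ^ N * (exp (b * norm y) / 64 ^ N)"
        by (rule mult_left_mono) auto
      also have "8 ^ N * (exp (b * norm y) / 64 ^ N) = exp (b * norm y) / 8 ^ N"
      proof -
        have "(64::real) ^ N = 8 ^ N * 8 ^ N" by (simp flip: power_mult_distrib)
        then show ?thesis by simp
      qed
      finally have "cmod (1 - S y) \<le> exp (b * norm y) / 8 ^ N"
        unfolding S_def c_def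
        using extrapolation_symbol[of "\<zeta> y" N] N by (simp add: \<zeta>_def)
      then have "cmod (1 - S y) * cmod (g y) \<le> exp (b * norm y) / 8 ^ N * cmod (g y)"
        by (intro mult_right_mono) auto
      moreover have "cis (s * (x \<bullet> y)) * g y - cis (s * (x \<bullet> y)) * S y * g y
          = cis (s * (x \<bullet> y)) * ((1 - S y) * g y)"
        by (simp add: algebra_simps)
      ultimately show "cmod (cis (s * (x \<bullet> y)) * g y - cis (s * (x \<bullet> y)) * S y * g y)
          \<le> (exp (b * norm y) * cmod (g y)) / 8 ^ N"
        by (simp add: norm_mult)
    qed (use intS cg eg in auto)
    finally show ?thesis by (simp add: M_def)
  qed
  ultimately show ?thesis
    unfolding extrapolable_def M_def f_def by blast
qed

section \<open>Observability from a ball\<close>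

lemma test_function_integrable:
  fixes u0 :: "'a::euclidean_space \<Rightarrow> complex" and h :: "'a \<Rightarrow> 'b::euclidean_space"
  assumes "test_function u0" and h: "continuous_on UNIV h" "\<And>x. u0 x = 0 \<Longrightarrow> h x = 0"
  shows "integrable lborel h"
proof -
  define K where "K = closure {x. u0 x \<noteq> 0}"
  have "compact K" using assms(1) by (simp add: test_function_def K_def)
  then have "integrable lborel (\<lambda>x. indicator K x *\<^sub>R h x)"
    using borel_integrable_compact continuous_on_subset[OF h(1) subset_UNIV] by blast
  moreover have "indicator K x *\<^sub>R h x = h x" for x
    using h(2)[of x] closure_subset[of "{x. u0 x \<noteq> 0}"] by (auto simp: indicator_def K_def)
  ultimately show ?thesis by simp
qed

lemma test_function_continuous: "test_function u0 \<Longrightarrow> continuous_on UNIV u0"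
  unfolding test_function_def by (metis continuously_differentiable.simps(1))

text \<open>Squares the conclusion of the propagation theorem and lowers its exponent from \<open>e\<close> to \<open>q\<close>.
  Lowering is harmless when the base is at most one, and otherwise the bound \<open>F \<le> M\<close> already suffices.\<close>

lemma power_interpolation:
  fixes F M \<mu> D A I q e :: real
  assumes "0 < M" "0 \<le> \<mu>" "0 \<le> F" "F \<le> M" and F: "F \<le> 81 * M * (\<mu> / (81 * M)) powr e"
    and q: "0 < q" "q \<le> e" "q < 1"
    and M2: "(81 * M)\<^sup>2 \<le> D * A" and \<mu>2: "\<mu>\<^sup>2 \<le> D * I" and "0 < D" "0 \<le> A" "0 \<le> I"
  shows "F\<^sup>2 \<le> D * (I powr q * A powr (1 - q))"
proof -
  define X where "X = 81 * M"
  define \<beta> where "\<beta> = \<mu> / X"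
  have X: "0 < X" using assms(1) by (simp add: X_def)
  have \<beta>: "0 \<le> \<beta>" using assms(2) X by (simp add: \<beta>_def)
  have "F \<le> X * \<beta> powr q"
  proof (cases "\<beta> \<le> 1")
    case True
    then have "\<beta> powr e \<le> \<beta> powr q" using q \<beta> by (intro powr_mono') auto
    then have "X * \<beta> powr e \<le> X * \<beta> powr q" using X by (intro mult_left_mono) auto
    then show ?thesis using F by (simp add: X_def \<beta>_def)
  next
    case False
    then have "1 \<le> \<beta> powr q" using q by (intro ge_one_powr_ge_zero) auto
    then have "X * 1 \<le> X * \<beta> powr q" using X by (intro mult_left_mono) auto
    moreover have "F \<le> X * 1" using assms(1,4) by (simp add: X_def)
    ultimately show ?thesis by linarith
  qed
  then have "F\<^sup>2 \<le> (X * \<beta> powr q)\<^sup>2" using assms(3) by (intro power_mono) auto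
  also have "\<dots> = X\<^sup>2 * (\<beta>\<^sup>2) powr q"
    using \<beta> by (simp add: power_mult_distrib power2_eq_square powr_mult)
  also have "(\<beta>\<^sup>2) powr q = (\<mu>\<^sup>2) powr q / (X\<^sup>2) powr q"
    using X assms(2) by (simp add: \<beta>_def power_divide powr_divide)
  also have "X\<^sup>2 * ((\<mu>\<^sup>2) powr q / (X\<^sup>2) powr q) = (\<mu>\<^sup>2) powr q * (X\<^sup>2) powr (1 - q)"
    using X by (simp add: powr_diff)
  also have "\<dots> \<le> (D * I) powr q * (D * A) powr (1 - q)"
    using M2 \<mu>2 q unfolding X_def[symmetric] by (intro mult_mono powr_mono2) auto
  also have "\<dots> = (D powr q * D powr (1 - q)) * (I powr q * A powr (1 - q))"
    using assms(11-13) by (simp add: powr_mult)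
  also have "D powr q * D powr (1 - q) = D"
    using assms(11) by (simp flip: powr_add)
  finally show ?thesis .
qed

text \<open>The propagation theorem is applied with \<open>s = - 1 / (2 T)\<close>, \<open>b = a / 4\<close> and \<open>d = \<rho> / 128\<close>;
  these satisfy \<open>|s| d = \<rho> / (256 T) \<le> a / 256 = b / 64\<close>.  In the constant, \<open>6561 = 81\<^sup>2\<close> comes from the
  factor \<open>81 M\<close> and \<open>384 = 3 * 128\<close> from comparing the volumes of balls of radius \<open>3 d\<close> and \<open>d\<close>,
  the latter expressed through \<open>\<rho>\<close>.\<close>

lemma schrodinger_pointwise_observability:
  fixes u0 :: "'a::euclidean_space \<Rightarrow> complex"
  assumes u0: "test_function u0" and ft: "integrable lborel (fourier_transform u0)"
    and pos: "0 < a" "0 < T" "0 < \<rho>" and \<rho>: "\<rho> \<le> a * T" "\<rho> \<le> r"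
    and q: "0 < q" "q < 1" "q \<le> (1/2) powr (128 * dist z y / \<rho> + 1)"
  defines "C \<equiv> max ((LINT y::'a|lborel. exp (- norm y)) * 6561 / (2 * pi) ^ DIM('a))
      (384 ^ DIM('a) / unit_ball_vol DIM('a))"
  shows "(cmod (schrodinger T u0 y))\<^sup>2 \<le> C / \<rho> ^ DIM('a) *
     ((LINT x:cball z r|lborel. (cmod (schrodinger T u0 x))\<^sup>2) powr q *
      (LINT x|lborel. exp (a * norm x) * (cmod (u0 x))\<^sup>2) powr (1 - q))"
proof -
  define n where "n = DIM('a)"
  define K where "K = (LINT y::'a|lborel. exp (- norm y))"
  define A where "A = (LINT x|lborel. exp (a * norm x) * (cmod (u0 x))\<^sup>2)"
  define c where "c = sqrt (1 / (4 * pi * T)) ^ n"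
  define g where "g y = of_real c * (cis ((norm y)\<^sup>2 / (4 * T)) * u0 y)" for y
  define f where "f x = (LINT y|lborel. cis (- 1 / (2 * T) * (x \<bullet> y)) * g y)" for x
  define I where "I = (LINT x:cball z r|lborel. (cmod (f x))\<^sup>2)"
  define b where "b = a / 4"
  define d where "d = \<rho> / 128"
  define M0 where "M0 = (LINT y|lborel. exp (b * norm y) * cmod (g y))"
  have c0: "0 < c" using pos by (simp add: c_def)
  have d: "0 < d" using pos by (simp add: d_def)
  note cont = test_function_continuous[OF u0]
  have int_u0: "integrable lborel u0" by (rule test_function_integrable[OF u0 cont])
  have cont_g: "continuous_on UNIV g"
    unfolding g_def using pos by (intro continuous_intros cont) auto
  have g0: "g x = 0" if "u0 x = 0" for x using that by (simp add: g_def)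
  have int_g: "integrable lborel g" by (rule test_function_integrable[OF u0 cont_g g0])
  have norm_g: "cmod (g y) = c * cmod (u0 y)" for y using c0 by (simp add: g_def norm_mult)
  have f_eq: "cmod (schrodinger T u0 x) = cmod (f x)" for x
  proof -
    have "f x = of_real c * (LINT y|lborel. cis (- 1 / (2 * T) * (x \<bullet> y)) * (cis ((norm y)\<^sup>2 / (4 * T)) * u0 y))"
      unfolding f_def g_def integral_mult_right_zero[symmetric] by (simp only: mult_ac)
    then show ?thesis
      using norm_schrodinger_eq_chirp_fourier[OF int_u0 ft pos(2), of x] c0
      unfolding n_def[symmetric] c_def[symmetric] by (simp add: norm_mult)
  qed
  have cont_f: "continuous_on UNIV f"
    unfolding f_def by (rule continuous_fourier_integral[OF int_g])
  have ext: "extrapolable d M0 f"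
    unfolding f_def M0_def
  proof (rule extrapolable_fourier_integral[OF int_g])
    show "integrable lborel (\<lambda>y. exp (b * norm y) * cmod (g y))"
      by (rule test_function_integrable[OF u0]) (auto intro!: continuous_intros cont_g simp: g0)
    show "0 < b" using pos by (simp add: b_def)
    have "\<rho> / (256 * T) \<le> a / 256" using \<rho>(1) pos by (simp add: field_simps)
    then show "\<bar>- 1 / (2 * T)\<bar> * d \<le> b / 64" using pos by (simp add: d_def b_def abs_divide)
  qed
  have K0: "0 \<le> K" unfolding K_def by (intro integral_nonneg_AE) auto
  have A0: "0 \<le> A" unfolding A_def by (intro integral_nonneg_AE) auto
  have I0: "0 \<le> I" unfolding I_def set_lebesgue_integral_def by (intro integral_nonneg_AE) auto
  have C: "0 < C" "K * 6561 / (2 * pi) ^ n \<le> C" "384 ^ n / unit_ball_vol n \<le> C"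
  proof -
    have "0 < 384 ^ n / unit_ball_vol n" by simp
    then show "0 < C" unfolding C_def n_def by (simp add: less_max_iff_disj)
  qed (auto simp: C_def K_def n_def)
  \<comment> \<open>Cauchy-Schwarz after writing \<open>exp (a |y| / 4)\<close> as \<open>exp (- a |y| / 4) * exp (a |y| / 2)\<close>.\<close>
  have M0: "M0\<^sup>2 \<le> K / (2 * pi) ^ n / \<rho> ^ n * A"
  proof -
    define J where "J = (LINT y|lborel. exp (- (a / 4 * norm y)) * (exp (a / 2 * norm y) * cmod (u0 y)))"
    have "M0 = c * J"
    proof -
      have "exp (b * norm y) * cmod (g y) = c * (exp (- (a / 4 * norm y)) * (exp (a / 2 * norm y) * cmod (u0 y)))" for y
        unfolding norm_g by (simp add: b_def algebra_simps flip: exp_add)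
      then show ?thesis unfolding M0_def J_def by simp
    qed
    moreover have "J\<^sup>2
       \<le> (LINT y|lborel. (exp (- (a / 4 * norm (y::'a))))\<^sup>2) * (LINT y|lborel. (exp (a / 2 * norm y) * cmod (u0 y))\<^sup>2)"
      unfolding J_def
    proof (rule integral_Cauchy_Schwarz)
      have "u0 \<in> borel_measurable borel" using cont by (rule borel_measurable_continuous_onI)
      then show "(\<lambda>y. exp (a / 2 * norm y) * cmod (u0 y)) \<in> borel_measurable lborel" by measurable
      show "integrable lborel (\<lambda>y. (exp (a / 2 * norm y) * cmod (u0 y))\<^sup>2)"
        by (rule test_function_integrable[OF u0]) (auto intro!: continuous_intros cont)
      show "integrable lborel (\<lambda>y::'a. (exp (- (a / 4 * norm y)))\<^sup>2)"
        using integrable_exp_minus_norm[of "a / 2"] pos by (simp add: power2_eq_square flip: exp_add)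
    qed measurable
    moreover have "(\<lambda>y. (exp (- (a / 4 * norm y)))\<^sup>2) = (\<lambda>y::'a. exp (- (a / 2 * norm y)))"
      by (auto simp: power2_eq_square simp flip: exp_add)
    moreover have "(\<lambda>y. (exp (a / 2 * norm y) * cmod (u0 y))\<^sup>2) = (\<lambda>y. exp (a * norm y) * (cmod (u0 y))\<^sup>2)"
    proof
      fix y :: 'a
      have "(exp (a / 2 * norm y))\<^sup>2 = exp (a * norm y)"
        by (simp add: power2_eq_square flip: exp_add)
      then show "(exp (a / 2 * norm y) * cmod (u0 y))\<^sup>2 = exp (a * norm y) * (cmod (u0 y))\<^sup>2"
        by (simp only: power_mult_distrib)
    qed
    moreover have "(LINT y::'a|lborel. exp (- (a / 2 * norm y))) = (1 / (a / 2)) ^ n * K"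
      unfolding n_def K_def using pos by (intro integral_exp_minus_norm_scale) simp
    ultimately have "M0\<^sup>2 \<le> c\<^sup>2 * ((1 / (a / 2)) ^ n * K * A)"
      by (simp only: power_mult_distrib A_def) (intro mult_left_mono, auto)
    also have "\<dots> = (c\<^sup>2 * (1 / (a / 2)) ^ n) * (K * A)" by simp
    also have "c\<^sup>2 * (1 / (a / 2)) ^ n = (1 / (2 * pi)) ^ n * (1 / (a * T)) ^ n"
    proof -
      have "c\<^sup>2 = (1 / (4 * pi * T)) ^ n"
        using pos by (simp add: c_def power_mult[symmetric] mult.commute[of n] power_mult)
      moreover have "1 / (4 * pi * T) * (1 / (a / 2)) = 1 / (2 * pi) * (1 / (a * T))"
        using pos by (simp add: field_simps)
      ultimately show ?thesis by (metis power_mult_distrib)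
    qed
    also have "\<dots> \<le> (1 / (2 * pi)) ^ n * (1 / \<rho>) ^ n"
      using pos \<rho> by (intro mult_left_mono power_mono frac_le) auto
    finally show ?thesis
      using K0 A0 by (simp add: mult_right_mono power_divide field_simps)
  qed
  have "(cmod (f y))\<^sup>2 \<le> C / \<rho> ^ n * (I powr q * A powr (1 - q))"
  proof (cases "A = 0")
    case True
    then have "M0 = 0" using M0 by simp
    then have "cmod (f y) = 0" using ext by (simp add: extrapolable_def)
    then show ?thesis using C(1) pos True by simp
  next
    case False
    define M where "M = sqrt (C / 6561 / \<rho> ^ n * A)"
    have M: "0 < M" using C(1) pos False A0 by (simp add: M_def)
    have M2: "(81 * M)\<^sup>2 = C / \<rho> ^ n * A"
      using C(1) pos A0 by (simp add: M_def power_mult_distrib)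
    have "K / (2 * pi) ^ n / \<rho> ^ n * A \<le> C / 6561 / \<rho> ^ n * A"
      using C(2) A0 pos by (intro mult_right_mono divide_right_mono) auto
    with M0 have "M0 \<le> M" unfolding M_def by (intro real_le_rsqrt) linarith
    then have extM: "extrapolable d M f" by (rule extrapolable_mono[OF ext])
    \<comment> \<open>Balls of radius \<open>(k + 1) d\<close> around \<open>z\<close> contain \<open>y\<close>.\<close>
    define k where "k = nat \<lfloor>dist z y / d\<rfloor>"
    have k: "dist z y / d \<le> real (Suc k)" "real (Suc k) \<le> dist z y / d + 1"
      using d by (auto simp: k_def of_nat_nat) linarith+
    define \<mu> where "\<mu> = sqrt (3 ^ DIM('a) / (unit_ball_vol DIM('a) * d ^ DIM('a))
      * (LINT x:cball z r|lborel. (cmod (f x))\<^sup>2))"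
    have \<mu>0: "0 \<le> \<mu>" using I0 d by (simp add: \<mu>_def I_def)
    have \<mu>2: "\<mu>\<^sup>2 \<le> C / \<rho> ^ n * I"
    proof -
      have "\<mu>\<^sup>2 = 3 ^ n / (unit_ball_vol n * d ^ n) * I"
        using I0 d by (simp add: \<mu>_def I_def n_def)
      also have "3 ^ n / (unit_ball_vol n * d ^ n) = 384 ^ n / unit_ball_vol n / \<rho> ^ n"
        using pos by (simp add: d_def power_divide field_simps flip: power_mult_distrib)
      also have "\<dots> * I \<le> C / \<rho> ^ n * I"
        using C(3) I0 pos by (intro mult_right_mono divide_right_mono) auto
      finally show ?thesis .
    qed
    show ?thesis
    proof (rule power_interpolation[OF M \<mu>0])
      show "cmod (f y) \<le> 81 * M * (\<mu> / (81 * M)) powr (1/2) ^ Suc k"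
        unfolding \<mu>_def
      proof (rule extrapolable_propagation_of_smallness[OF extM d M cont_f])
        show "3 * d \<le> r" using \<rho>(2) pos by (simp add: d_def)
        show "dist z y \<le> real (Suc k) * d" using k(1) d by (simp add: field_simps)
      qed
      have "q \<le> (1/2) powr (128 * dist z y / \<rho> + 1)" by (rule q)
      also have "\<dots> \<le> (1/2) powr real (Suc k)"
        using k(2) by (intro powr_mono') (auto simp: d_def mult.commute)
      also have "\<dots> = (1/2) ^ Suc k" by (rule powr_realpow) simp
      finally show "q \<le> (1/2) ^ Suc k" .
      show "cmod (f y) \<le> M" using extM by (simp add: extrapolable_def)
      show "(81 * M)\<^sup>2 \<le> C / \<rho> ^ n * A" using M2 by simp
      show "0 < C / \<rho> ^ n" using C(1) pos by simp
    qed (use q \<mu>2 A0 I0 in auto)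
  qed
  then show ?thesis
    unfolding f_eq by (simp only: I_def A_def n_def)
qed

theorem theorem1p3:
  shows "\<exists>C > 0. \<exists>\<theta>. 0 < \<theta> \<and> \<theta> < 1 \<and>
    (\<forall>(x' :: real ^ 'n) (x'' :: real ^ 'n) (r1 :: real) (r2 :: real) (a :: real) (T :: real)
       (u0 :: real ^ 'n \<Rightarrow> complex).
      r1 > 0 \<longrightarrow> r2 > 0 \<longrightarrow> a > 0 \<longrightarrow> T > 0 \<longrightarrow> test_function u0 \<longrightarrow>
      (let p = 1 + (norm (x' - x'') + r1 + r2) / min (a * T) r1 in
        (LINT x:cball x'' r2|lborel. (cmod (schrodinger T u0 x))\<^sup>2)
          \<le> C * r2 ^ CARD('n) * (min (a * T) r1) powi (- int CARD('n))
              * (LINT x:cball x' r1|lborel. (cmod (schrodinger T u0 x))\<^sup>2) powr (\<theta> powr p)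
              * (LINT x|lborel. exp (a * norm x) * (cmod (u0 x))\<^sup>2) powr (1 - \<theta> powr p)))"
proof -
  define n where "n = CARD('n)"
  define \<omega> where "\<omega> = unit_ball_vol n"
  define C where "C = max ((LINT y::real^'n|lborel. exp (- norm y)) * 6561 / (2 * pi) ^ n) (384 ^ n / \<omega>)"
  \<comment> \<open>Each step of length \<open>\<rho> / 128\<close> halves the exponent, so a distance \<open>\<rho>\<close> costs a factor \<open>2\<^bsup>- 128\<^esup>\<close>.\<close>
  define \<theta> :: real where "\<theta> = (1/2) powr 128"
  have \<omega>: "0 < \<omega>" by (simp add: \<omega>_def)
  have "0 < 384 ^ n / \<omega>" using \<omega> by simp
  then have C: "0 < C" unfolding C_def by (simp add: less_max_iff_disj)
  have \<theta>: "0 < \<theta>" "\<theta> < 1" unfolding \<theta>_def by (simp, subst powr01_less_one) auto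
  have "(LINT x:cball x'' r2|lborel. (cmod (schrodinger T u0 x))\<^sup>2)
        \<le> (C * \<omega>) * r2 ^ n * (min (a * T) r1) powi (- int n)
              * (LINT x:cball x' r1|lborel. (cmod (schrodinger T u0 x))\<^sup>2) powr (\<theta> powr p)
              * (LINT x|lborel. exp (a * norm x) * (cmod (u0 x))\<^sup>2) powr (1 - \<theta> powr p)"
    if pos: "0 < r1" "0 < r2" "0 < a" "0 < T" and u0: "test_function u0"
      and p: "p = 1 + (norm (x' - x'') + r1 + r2) / min (a * T) r1"
    for x' x'' :: "real ^ 'n" and r1 r2 a T p :: real and u0
  proof (cases "integrable lborel (fourier_transform u0)")
    case False
    then show ?thesis
      using schrodinger_eq_0[OF False] C \<omega> pos by (simp add: set_lebesgue_integral_def)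
  next
    case True
    define \<rho> where "\<rho> = min (a * T) r1"
    define q where "q = \<theta> powr p"
    define B where "B = C / \<rho> ^ n *
      ((LINT x:cball x' r1|lborel. (cmod (schrodinger T u0 x))\<^sup>2) powr q *
       (LINT x|lborel. exp (a * norm x) * (cmod (u0 x))\<^sup>2) powr (1 - q))"
    have \<rho>: "0 < \<rho>" "\<rho> \<le> a * T" "\<rho> \<le> r1" using pos by (auto simp: \<rho>_def)
    have p1: "1 \<le> p" using \<rho>(1) pos unfolding p \<rho>_def[symmetric] by simp
    have q: "0 < q" "q < 1" using \<theta> p1 by (auto simp: q_def powr01_less_one)
    have B0: "0 \<le> B" using C \<rho> by (simp add: B_def)
    have pw: "(cmod (schrodinger T u0 y))\<^sup>2 \<le> B" if y: "y \<in> cball x'' r2" for y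
    proof -
      have "dist x' y \<le> norm (x' - x'') + r2"
        using y dist_triangle[of x' y x''] by (simp add: dist_norm)
      then have "dist x' y \<le> norm (x' - x'') + r1 + r2" using pos by simp
      then have "dist x' y / \<rho> \<le> p - 1"
        unfolding p \<rho>_def[symmetric] using \<rho>(1) by (simp add: divide_right_mono)
      then have "128 * dist x' y / \<rho> + 1 \<le> 128 * p" by simp
      then have "(1/2) powr (128 * p) \<le> (1/2) powr (128 * dist x' y / \<rho> + 1)"
        by (intro powr_mono') auto
      moreover have "q = (1/2) powr (128 * p)" by (simp only: q_def \<theta>_def powr_powr)
      ultimately have "q \<le> (1/2) powr (128 * dist x' y / \<rho> + 1)" by simp
      from schrodinger_pointwise_observability[OF u0 True pos(3,4) \<rho> q this]
      show ?thesis by (simp add: B_def C_def \<omega>_def n_def)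
    qed
    have "(LINT x:cball x'' r2|lborel. (cmod (schrodinger T u0 x))\<^sup>2)
        \<le> (LINT x:cball x'' r2|lborel. B)"
      unfolding set_lebesgue_integral_def
    proof (rule integral_mono')
      show "integrable lborel (\<lambda>x. indicator (cball x'' r2) x *\<^sub>R B)"
        by (intro integrable_scaleR_left integrable_indicator_cball)
    qed (use pw B0 in \<open>auto simp: indicator_def\<close>)
    also have "\<dots> = \<omega> * r2 ^ n * B"
      using integrable_indicator_cball[of x'' r2] content_cball[of r2 x''] pos
      by (simp add: set_lebesgue_integral_def \<omega>_def n_def)
    finally show ?thesis
      by (simp add: B_def \<rho>_def q_def power_int_minus divide_inverse mult_ac)
  qed
  then show ?thesis
    using C \<omega> \<theta> unfolding n_def Let_def by (intro exI[of _ "C * \<omega>"] exI[of _ \<theta>] conjI) auto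
qed

end
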